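(* Let $\mathbf{X}=(X_1,\dots,X_n)$ be the output of $\textsc{DepRound}$ run with probabilities $(p_1,\dots,p_n)\in[0,1]^n$ and unit weights $(1,\dots,1)$. Let $\alpha_i:=\min\{p_i,1-p_i\}$. Let $I^+,I^-$ be disjoint subsets of $[n]$, $I:=I^+\cup I^-$, $t:=|I|$, $J:=[n]\setminus I$ (assumed nonempty); let $q_i:=p_i$ for $i\in I^+$ and $q_i:=1-p_i$ for $i\in I^-$ (assumed positive). Define $\lambda:=\prod_{i\in I^+}p_i\prod_{i\in I^-}(1-p_i)$, $\hat\alpha:=\frac{1}{|J|}\sum_{j\in J}\alpha_j$ (assumed positive), and $\hat q$ by $\frac{1}{\hat q}:=\frac{1}{|I|}\sum_{i\in I}\frac{1}{q_i}$. Then $$\left(1-\frac{t(t-1)}{n\hat q\hat\alpha}\right)\lambda\le\mathbf{E}\left[\prod_{i\in I^+}X_i\prod_{i\in I^-}(1-X_i)\right]\le\left(1+\frac{t}{n\hat q\hat\alpha}\right)^{t-1}\lambda.$$ Furthermore, if $\sum_ip_i$ is an integer, then $\mathbf{X}$ has no fractional entries.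
   Context: With unit weights, $\textsc{Simplify}(1,1,\beta_1,\beta_2)$ for $\beta_1,\beta_2\in(0,1)$ outputs $(\gamma_1,\gamma_2)$ as follows: let $s=\beta_1+\beta_2$. If $s\le 1$: w.p. $\beta_2/s$ set $(\gamma_1,\gamma_2)=(0,\beta_1+\beta_2)$, otherwise $(\gamma_1,\gamma_2)=(\beta_1+\beta_2,0)$. If $s>1$: w.p. $(1-\beta_2)/((1-\beta_1)+(1-\beta_2))$ set $(\gamma_1,\gamma_2)=(1,\beta_1+\beta_2-1)$, otherwise $(\gamma_1,\gamma_2)=(\beta_1+\beta_2-1,1)$. $\textsc{DepRound}$ with $P=(p_1,\dots,p_n)$ and unit weights: set $X=P$; choose a uniformly random permutation $\pi$ of $[n]$; while $X$ has at least two entries in $(0,1)$, let $X_i,X_j$ be the two fractional entries earliest in the $\pi$-order ($X_i$ first) and replace $(X_i,X_j)$ by $\textsc{Simplify}(1,1,X_i,X_j)$; output $X$. *)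

theory Defs
  imports "HOL-Probability.Probability" "HOL-Combinatorics.Permutations"
begin

text \<open>
  Vectors indexed by \<open>[n]\<close> are functions \<open>nat \<Rightarrow> real\<close> of which only the values on \<open>{1..n}\<close>
  matter; values outside that set are never read and never changed.
\<close>

text \<open>
  Simplify and dependent rounding for unit weights \<open>(1, \<dots>, 1)\<close>. The sum of the two arguments is
  preserved, and for arguments in \<open>(0, 1)\<close> so are their means.
\<close>

definition simplify :: "real \<Rightarrow> real \<Rightarrow> (real \<times> real) pmf" where
  "simplify \<beta>\<^sub>1 \<beta>\<^sub>2 =
     (if \<beta>\<^sub>1 + \<beta>\<^sub>2 \<le> 1
      then map_pmf (\<lambda>c. if c then (0, \<beta>\<^sub>1 + \<beta>\<^sub>2) else (\<beta>\<^sub>1 + \<beta>\<^sub>2, 0))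
             (bernoulli_pmf (\<beta>\<^sub>2 / (\<beta>\<^sub>1 + \<beta>\<^sub>2)))
      else map_pmf (\<lambda>c. if c then (1, \<beta>\<^sub>1 + \<beta>\<^sub>2 - 1) else (\<beta>\<^sub>1 + \<beta>\<^sub>2 - 1, 1))
             (bernoulli_pmf ((1 - \<beta>\<^sub>2) / ((1 - \<beta>\<^sub>1) + (1 - \<beta>\<^sub>2)))))"

definition fractional :: "nat \<Rightarrow> (nat \<Rightarrow> real) \<Rightarrow> nat set" where
  "fractional n X = {i \<in> {1..n}. X i \<in> {0<..<1}}"

lemma finite_fractional [simp]: "finite (fractional n X)"
  by (simp add: fractional_def)

lemma simplify_not_both_fractional:
  assumes "(a, b) \<in> set_pmf (simplify x y)"
  shows "a \<notin> {0<..<1} \<or> b \<notin> {0<..<1}"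
  using assms by (auto simp: simplify_def split: if_splits)

lemma card_fractional_less:
  assumes "i \<in> fractional n X" "j \<in> fractional n X" "i \<noteq> j"
    and "a \<notin> {0<..<1} \<or> b \<notin> {0<..<1}"
  shows "card (fractional n (X(i := a, j := b))) < card (fractional n X)"
proof (rule psubset_card_mono)
  show "fractional n (X(i := a, j := b)) \<subset> fractional n X"
    using assms by (auto simp: fractional_def split: if_splits)
qed simp

text \<open>
  The index \<open>i\<close> stands at position \<open>\<pi> i\<close> of the order, so \<open>i\<close> precedes \<open>j\<close> iff \<open>\<pi> i < \<pi> j\<close>.
\<close>

function dep_round_loop :: "nat \<Rightarrow> (nat \<Rightarrow> nat) \<Rightarrow> (nat \<Rightarrow> real) \<Rightarrow> (nat \<Rightarrow> real) pmf" where
  "dep_round_loop n \<pi> X =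
     (if card (fractional n X) \<ge> 2
      then let i = arg_min_on \<pi> (fractional n X);
               j = arg_min_on \<pi> (fractional n X - {i})
           in bind_pmf (simplify (X i) (X j))
                (\<lambda>\<gamma>. dep_round_loop n \<pi> (X(i := fst \<gamma>, j := snd \<gamma>)))
      else return_pmf X)"
  by pat_completeness auto
termination
proof (relation "Wellfounded.measure (\<lambda>(n, \<pi>, X). card (fractional n X))", goal_cases)
  case 1
  show ?case by simp
next
  case (2 n \<pi> X i j \<gamma>)
  let ?F = "fractional n X"
  have ne: "?F \<noteq> {}" and ne': "?F - {i} \<noteq> {}"
    using 2(1) by (auto dest: card_mono[rotated])
  have "i \<in> ?F"
    using ne 2(2) by (simp add: arg_min_if_finite(1))
  moreover have "j \<in> ?F - {i}"
    unfolding 2(3) by (rule arg_min_if_finite(1)) (use ne' in auto)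
  moreover have "fst \<gamma> \<notin> {0<..<1} \<or> snd \<gamma> \<notin> {0<..<1}"
    using 2(4) by (intro simplify_not_both_fractional) simp
  ultimately show ?case
    by (auto intro!: card_fractional_less)
qed

declare dep_round_loop.simps [simp del]

definition dep_round :: "nat \<Rightarrow> (nat \<Rightarrow> real) \<Rightarrow> (nat \<Rightarrow> real) pmf" where
  "dep_round n p =
     bind_pmf (pmf_of_set {\<pi>. \<pi> permutes {1..n}}) (\<lambda>\<pi>. dep_round_loop n \<pi> p)"

end

theory Submission
  imports Defs "HOL-Combinatorics.Multiset_Permutations"
begin

text \<open>
  Fix the order \<open>\<pi>\<close>. At any time at most one already visited index, the carrier \<open>c\<close>, is fractional.
  Let \<open>W\<close> be the product of the literals \<open>Y\<^sub>i\<close> (\<open>X\<^sub>i\<close> or \<open>1 - X\<^sub>i\<close>) over \<open>I\<close>, and let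
  \<open>V = W (1 - Y\<^sub>c)\<close> if \<open>c \<in> I\<close>, \<open>V = 0\<close> otherwise. Visiting \<open>j \<notin> I\<close> preserves the mean of \<open>W\<close> and
  shrinks that of \<open>V\<close> by a factor \<open>1 - \<alpha>\<^sub>j\<close> at least; visiting \<open>i \<in> I\<close> changes the mean of \<open>W\<close> by at
  most \<open>V / q\<^sub>i\<close>, because the two entries have covariance at most \<open>X\<^sub>c (1 - X\<^sub>c)\<close> in absolute value.
  This bounds \<open>E W\<close> above by a product, over the indices \<open>i \<in> I\<close> but the first, of
  \<open>1 + (1 / q\<^sub>i) \<Prod>\<^sub>j (1 - \<alpha>\<^sub>j)\<close>, where \<open>j\<close> runs over the indices between \<open>i\<close> and its predecessor in \<open>I\<close>.

  This bound is multiaffine in the numbers \<open>1 / q\<^sub>i\<close> and \<open>1 - \<alpha>\<^sub>j\<close>, with nonnegative coefficients, so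
  after averaging over \<open>\<pi>\<close> it can only grow if these numbers are replaced by their means (a form of
  Maclaurin's inequality). With constant entries only the pattern of \<open>I\<close> in the order matters, and a
  recursion on the first index gives the upper bound. The lower bound uses the linear part of the
  same product.
\<close>

section \<open>Averages over permutations\<close>

lemma sum_permutes_swap:
  assumes "x \<in> J" "y \<in> J"
  shows "(\<Sum>\<sigma> | \<sigma> permutes J. f \<sigma>) = (\<Sum>\<sigma> | \<sigma> permutes J. f (\<sigma> \<circ> Transposition.transpose x y))"
  using assms
  by (intro sum.reindex_bij_witness[of _ "\<lambda>\<sigma>. \<sigma> \<circ> Transposition.transpose x y" "\<lambda>\<sigma>. \<sigma> \<circ> Transposition.transpose x y"])
     (auto intro!: permutes_compose permutes_swap_id simp: comp_assoc)

text \<open>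
  The case \<open>l \<in> L\<close> is the only strict one: pairing \<open>\<sigma>\<close> with \<open>\<sigma> \<circ> (y l)\<close> reduces it to
  \<open>2 a b \<le> a\<^sup>2 + b\<^sup>2\<close>.
\<close>

lemma sum_permutes_prod_insert_le:
  fixes a :: "'a \<Rightarrow> real"
  assumes J: "finite J" and a: "\<And>j. j \<in> J \<Longrightarrow> a j \<ge> 0"
    and L: "L \<subseteq> J" and y: "y \<in> J" "y \<notin> L" and l: "l \<in> J"
  shows "(\<Sum>\<sigma> | \<sigma> permutes J. (\<Prod>x\<in>L. a (\<sigma> x)) * a (\<sigma> y))
       \<le> (\<Sum>\<sigma> | \<sigma> permutes J. (\<Prod>x\<in>L. a (\<sigma> x)) * a (\<sigma> l))"
proof (cases "l \<in> L")
  case False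
  have "(\<Prod>x\<in>L. a ((\<sigma> \<circ> Transposition.transpose y l) x)) * a ((\<sigma> \<circ> Transposition.transpose y l) y)
      = (\<Prod>x\<in>L. a (\<sigma> x)) * a (\<sigma> l)" for \<sigma>
  proof -
    have "(\<Prod>x\<in>L. a ((\<sigma> \<circ> Transposition.transpose y l) x)) = (\<Prod>x\<in>L. a (\<sigma> x))"
      using False y by (intro prod.cong) (auto simp: Transposition.transpose_def)
    then show ?thesis by simp
  qed
  then show ?thesis
    unfolding sum_permutes_swap[OF y(1) l, of "\<lambda>\<sigma>. (\<Prod>x\<in>L. a (\<sigma> x)) * a (\<sigma> y)"]
    by (simp only: order_refl)
next
  case True
  let ?Q = "\<lambda>\<sigma>. \<Prod>x\<in>L - {l}. a (\<sigma> x)"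
  have fL: "finite L" using J L by (rule finite_subset[rotated])
  have split: "(\<Prod>x\<in>L. a (\<sigma> x)) = a (\<sigma> l) * ?Q \<sigma>" for \<sigma>
    using True fL by (simp add: prod.remove)
  have Q_swap: "?Q (\<sigma> \<circ> Transposition.transpose y l) = ?Q \<sigma>" for \<sigma>
    using y by (intro prod.cong) (auto simp: Transposition.transpose_def)
  let ?S = "\<lambda>f. \<Sum>\<sigma> | \<sigma> permutes J. f \<sigma>"
  have sw: "?S (\<lambda>\<sigma>. a (\<sigma> l) * ?Q \<sigma> * a (\<sigma> l)) = ?S (\<lambda>\<sigma>. a (\<sigma> y) * ?Q \<sigma> * a (\<sigma> y))"
    using sum_permutes_swap[OF y(1) l, of "\<lambda>\<sigma>. a (\<sigma> l) * ?Q \<sigma> * a (\<sigma> l)"] Q_swap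
    by (simp add: o_def)
  have "2 * ?S (\<lambda>\<sigma>. a (\<sigma> l) * ?Q \<sigma> * a (\<sigma> y)) = ?S (\<lambda>\<sigma>. 2 * a (\<sigma> l) * ?Q \<sigma> * a (\<sigma> y))"
    by (simp add: sum_distrib_left mult.assoc)
  also have "\<dots> \<le> ?S (\<lambda>\<sigma>. a (\<sigma> l) * ?Q \<sigma> * a (\<sigma> l) + a (\<sigma> y) * ?Q \<sigma> * a (\<sigma> y))"
  proof (rule sum_mono)
    fix \<sigma> assume "\<sigma> \<in> {\<sigma>. \<sigma> permutes J}"
    then have "?Q \<sigma> \<ge> 0"
      using L by (intro prod_nonneg a) (auto simp: permutes_in_image)
    then have "0 \<le> ?Q \<sigma> * (a (\<sigma> l) - a (\<sigma> y))^2" by simp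
    then show "2 * a (\<sigma> l) * ?Q \<sigma> * a (\<sigma> y)
        \<le> a (\<sigma> l) * ?Q \<sigma> * a (\<sigma> l) + a (\<sigma> y) * ?Q \<sigma> * a (\<sigma> y)"
      by (simp add: power2_eq_square algebra_simps)
  qed
  also have "\<dots> = 2 * ?S (\<lambda>\<sigma>. a (\<sigma> l) * ?Q \<sigma> * a (\<sigma> l))"
    by (simp add: sum.distrib flip: sw)
  finally show ?thesis by (simp add: split)
qed

text \<open>Induction on \<open>L\<close>. By the preceding lemma the new factor
  \<open>a (\<sigma> y)\<close> may be replaced by the average of \<open>a (\<sigma> l)\<close> over
  all \<open>l\<close> in \<open>J\<close>. This average is \<open>sum a J / card J\<close> whatever
  \<open>\<sigma>\<close> is, so it leaves the sum.\<close>

lemma sum_permutes_prod_le: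
  fixes a :: "'a \<Rightarrow> real"
  assumes J: "finite J" "J \<noteq> {}" and a: "\<And>j. j \<in> J \<Longrightarrow> a j \<ge> 0" and L: "L \<subseteq> J"
  shows "(\<Sum>\<sigma> | \<sigma> permutes J. \<Prod>x\<in>L. a (\<sigma> x)) \<le> fact (card J) * (sum a J / card J) ^ card L"
proof -
  have "finite L" using J L by (auto intro: finite_subset)
  then show ?thesis using L
  proof (induction L rule: finite_induct)
    case empty
    then show ?case using J by (simp add: card_permutations)
  next
    case (insert y L)
    let ?S = "\<lambda>f. \<Sum>\<sigma> | \<sigma> permutes J. f \<sigma>"
    have "card J * ?S (\<lambda>\<sigma>. (\<Prod>x\<in>L. a (\<sigma> x)) * a (\<sigma> y))
        = (\<Sum>l\<in>J. ?S (\<lambda>\<sigma>. (\<Prod>x\<in>L. a (\<sigma> x)) * a (\<sigma> y)))" by simp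
    also have "\<dots> \<le> (\<Sum>l\<in>J. ?S (\<lambda>\<sigma>. (\<Prod>x\<in>L. a (\<sigma> x)) * a (\<sigma> l)))"
      using insert J a by (intro sum_mono sum_permutes_prod_insert_le) auto
    also have "\<dots> = ?S (\<lambda>\<sigma>. (\<Prod>x\<in>L. a (\<sigma> x)) * (\<Sum>l\<in>J. a (\<sigma> l)))"
      by (subst sum.swap) (simp add: sum_distrib_left)
    also have "\<dots> = ?S (\<lambda>\<sigma>. (\<Prod>x\<in>L. a (\<sigma> x)) * sum a J)"
      by (intro sum.cong) (auto simp: sum.permute[of _ J a] o_def)
    also have "\<dots> = sum a J * ?S (\<lambda>\<sigma>. \<Prod>x\<in>L. a (\<sigma> x))"
      by (simp add: sum_distrib_left mult.commute)
    also have "\<dots> \<le> sum a J * (fact (card J) * (sum a J / card J) ^ card L)"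
      using insert a by (intro mult_left_mono sum_nonneg) auto
    finally have "?S (\<lambda>\<sigma>. (\<Prod>x\<in>L. a (\<sigma> x)) * a (\<sigma> y))
        \<le> sum a J * (fact (card J) * (sum a J / card J) ^ card L) / card J"
      using J by (simp add: field_simps card_gt_0_iff)
    then show ?case using insert by (simp add: mult_ac)
  qed
qed

section \<open>The chain bound and its symmetrization\<close>

text \<open>
  Here \<open>w\<close> and \<open>v\<close> bound the means of \<open>W\<close> and \<open>V\<close>, and \<open>h\<close> is \<open>1 / q\<close> on \<open>I\<close> and \<open>1 - \<alpha>\<close> elsewhere.
  After an index of \<open>I\<close>, \<open>V\<close> is bounded by \<open>W\<close>.
\<close>

fun chain_bound :: "'a set \<Rightarrow> ('a \<Rightarrow> real) \<Rightarrow> 'a list \<Rightarrow> real \<Rightarrow> real \<Rightarrow> real" where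
  "chain_bound I h [] w v = w"
| "chain_bound I h (x # xs) w v =
     (if x \<in> I then chain_bound I h xs (w + h x * v) (w + h x * v) else chain_bound I h xs w (h x * v))"

text \<open>Linearity in the pair lets the two outcomes of a loop step be averaged inside the bound,
  and lets the value of the head of the list be split off as an affine variable.\<close>

lemma chain_bound_linear:
  "chain_bound I h xs (r * w + r' * w') (r * v + r' * v') = r * chain_bound I h xs w v + r' * chain_bound I h xs w' v'"
proof (induction xs arbitrary: w v w' v')
  case (Cons x xs)
  have 1: "r * w + r' * w' + h x * (r * v + r' * v') = r * (w + h x * v) + r' * (w' + h x * v')"
    and 2: "h x * (r * v + r' * v') = r * (h x * v) + r' * (h x * v')"
    by (simp_all add: algebra_simps)
  show ?case
    by (cases "x \<in> I") (simp only: chain_bound.simps if_True 1 Cons.IH, simp only: chain_bound.simps if_False 2 Cons.IH)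
qed simp

lemma chain_bound_mono:
  assumes "\<And>x. x \<in> set xs \<Longrightarrow> h x \<ge> 0" "w \<le> w'" "v \<le> v'"
  shows "chain_bound I h xs w v \<le> chain_bound I h xs w' v'"
  using assms
proof (induction xs arbitrary: w v w' v')
  case (Cons x xs)
  then have "h x * v \<le> h x * v'" by (intro mult_left_mono) auto
  with Cons show ?case by (auto intro!: Cons.IH add_mono)
qed simp

lemma chain_bound_map:
  assumes "\<And>x. \<sigma> x \<in> I \<longleftrightarrow> x \<in> I"
  shows "chain_bound I h (map \<sigma> xs) w v = chain_bound I (h \<circ> \<sigma>) xs w v"
  using assms by (induction xs arbitrary: w v) auto

text \<open>Each entry of a distinct list is read once, and its value enters affinely with
  nonnegative coefficients. Since \<open>C\<close> does not depend on \<open>h\<close>, one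
  expansion serves all relabellings \<open>h \<circ> \<sigma>\<close>.\<close>

lemma chain_bound_multiaffine:
  assumes "distinct xs" "w \<ge> 0" "v \<ge> 0"
  shows "\<exists>C. (\<forall>L. C L \<ge> 0) \<and> (\<forall>h. chain_bound I h xs w v = (\<Sum>L\<in>Pow (set xs). C L * (\<Prod>x\<in>L. h x)))"
  using assms
proof (induction xs arbitrary: w v)
  case Nil
  then show ?case by (intro exI[of _ "\<lambda>_. w"]) simp
next
  case (Cons x xs)
  \<comment> \<open>Linearity separates the part free of \<open>h x\<close> from the coefficient of
    \<open>h x\<close>; both are chain bounds of the tail.\<close>
  obtain w1 v1 w2 v2 where nonneg: "w1 \<ge> 0" "v1 \<ge> 0" "w2 \<ge> 0" "v2 \<ge> 0"
    and eq: "\<And>h. chain_bound I h (x # xs) w v = chain_bound I h xs w1 v1 + h x * chain_bound I h xs w2 v2"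
  proof (cases "x \<in> I")
    case True
    then have "chain_bound I h (x # xs) w v = chain_bound I h xs w w + h x * chain_bound I h xs v v" for h
      using chain_bound_linear[of I h xs 1 w "h x" v w v] by simp
    with that[of w w v v] Cons.prems show ?thesis by simp
  next
    case False
    then have "chain_bound I h (x # xs) w v = chain_bound I h xs w 0 + h x * chain_bound I h xs 0 v" for h
      using chain_bound_linear[of I h xs 1 w "h x" 0 0 v] by simp
    with that[of w 0 0 v] Cons.prems show ?thesis by simp
  qed
  obtain C1 where C1: "\<And>L. C1 L \<ge> 0"
      "\<And>h. chain_bound I h xs w1 v1 = (\<Sum>L\<in>Pow (set xs). C1 L * (\<Prod>x\<in>L. h x))"
    using Cons.IH[of w1 v1] Cons.prems nonneg by auto
  obtain C2 where C2: "\<And>L. C2 L \<ge> 0"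
      "\<And>h. chain_bound I h xs w2 v2 = (\<Sum>L\<in>Pow (set xs). C2 L * (\<Prod>x\<in>L. h x))"
    using Cons.IH[of w2 v2] Cons.prems nonneg by auto
  define C where "C L = (if x \<in> L then C2 (L - {x}) else C1 L)" for L
  have x: "x \<notin> set xs" using Cons.prems by simp
  have "chain_bound I h (x # xs) w v = (\<Sum>L\<in>Pow (set (x # xs)). C L * (\<Prod>x\<in>L. h x))" for h
  proof -
    have inj: "inj_on (insert x) (Pow (set xs))"
      using x by (auto simp: inj_on_def insert_eq_iff dest: subsetD)
    have "(\<Sum>L\<in>Pow (set (x # xs)). C L * (\<Prod>x\<in>L. h x))
        = (\<Sum>L\<in>Pow (set xs). C L * (\<Prod>x\<in>L. h x))
        + (\<Sum>L\<in>insert x ` Pow (set xs). C L * (\<Prod>x\<in>L. h x))"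
      using x unfolding list.set Pow_insert by (intro sum.union_disjoint) auto
    also have "(\<Sum>L\<in>Pow (set xs). C L * (\<Prod>x\<in>L. h x)) = chain_bound I h xs w1 v1"
      unfolding C1 using x by (intro sum.cong) (auto simp: C_def)
    also have "(\<Sum>L\<in>insert x ` Pow (set xs). C L * (\<Prod>x\<in>L. h x)) = h x * chain_bound I h xs w2 v2"
      unfolding C2 sum.reindex[OF inj] sum_distrib_left
    proof (intro sum.cong refl)
      fix L assume "L \<in> Pow (set xs)"
      with x have "x \<notin> L" "finite L" by (auto intro: finite_subset)
      then show "((\<lambda>L. C L * prod h L) \<circ> insert x) L = h x * (C2 L * prod h L)"
        by (simp add: C_def)
    qed
    finally show ?thesis unfolding eq by (rule sym)
  qed
  then show ?case
    using C1(1) C2(1) by (intro exI[of _ C]) (auto simp: C_def)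
qed

lemma sum_permutations_of_set_map:
  assumes "\<sigma> permutes S"
  shows "(\<Sum>xs\<in>permutations_of_set S. f (map \<sigma> xs)) = (\<Sum>xs\<in>permutations_of_set S. f xs)"
proof (rule sum.reindex_bij_witness[of _ "map (inv \<sigma>)" "map \<sigma>"])
  fix xs assume xs: "xs \<in> permutations_of_set S"
  have inj: "inj \<sigma>" "inj (inv \<sigma>)"
    using assms permutes_inj permutes_inv by blast+
  show "map \<sigma> xs \<in> permutations_of_set S" "map (inv \<sigma>) xs \<in> permutations_of_set S"
    using xs inj permutes_image[OF assms] permutes_image[OF permutes_inv[OF assms]]
    by (auto simp: permutations_of_set_def distinct_map intro: inj_on_subset)
qed (simp_all add: o_def permutes_inverses[OF assms])

text \<open>The sum over all orders is invariant under relabelling by a permutation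
  \<open>\<sigma>\<close> of \<open>J\<close>, provided that \<open>\<sigma>\<close> respects
  \<open>I\<close>; hence the alternative on \<open>J\<close>. Averaging over
  \<open>\<sigma>\<close> then acts on each monomial separately, where
  \<open>sum_permutes_prod_le\<close> puts the mean in place of the values on
  \<open>J\<close>.\<close>

lemma sum_chain_bound_symmetrize:
  assumes S: "finite S" "J \<subseteq> S" "J \<noteq> {}" and J: "J \<subseteq> I \<or> J \<inter> I = {}"
    and h: "\<And>x. x \<in> S \<Longrightarrow> h x \<ge> 0" and wv: "w \<ge> 0" "v \<ge> 0"
  shows "(\<Sum>xs\<in>permutations_of_set S. chain_bound I h xs w v)
       \<le> (\<Sum>xs\<in>permutations_of_set S. chain_bound I (\<lambda>x. if x \<in> J then sum h J / card J else h x) xs w v)"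
proof -
  let ?h = "\<lambda>x. if x \<in> J then sum h J / card J else h x"
  have fJ: "finite J" using S finite_subset by blast
  have "fact (card J) * (\<Sum>xs\<in>permutations_of_set S. chain_bound I h xs w v)
      = (\<Sum>\<sigma> | \<sigma> permutes J. \<Sum>xs\<in>permutations_of_set S. chain_bound I h xs w v)"
    using fJ by (simp add: card_permutations)
  also have "\<dots> = (\<Sum>\<sigma> | \<sigma> permutes J. \<Sum>xs\<in>permutations_of_set S. chain_bound I (h \<circ> \<sigma>) xs w v)"
  proof (rule sum.cong[OF refl])
    fix \<sigma> assume "\<sigma> \<in> {\<sigma>. \<sigma> permutes J}"
    then have \<sigma>: "\<sigma> permutes J" by simp
    have "\<sigma> x \<in> I \<longleftrightarrow> x \<in> I" for x
      using J permutes_in_image[OF \<sigma>, of x] permutes_not_in[OF \<sigma>, of x] by (cases "x \<in> J") auto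
    then show "(\<Sum>xs\<in>permutations_of_set S. chain_bound I h xs w v)
        = (\<Sum>xs\<in>permutations_of_set S. chain_bound I (h \<circ> \<sigma>) xs w v)"
      using sum_permutations_of_set_map[OF permutes_subset[OF \<sigma> S(2)], of "\<lambda>xs. chain_bound I h xs w v"]
      by (simp add: chain_bound_map)
  qed
  also have "\<dots> = (\<Sum>xs\<in>permutations_of_set S. \<Sum>\<sigma> | \<sigma> permutes J. chain_bound I (h \<circ> \<sigma>) xs w v)"
    by (rule sum.swap)
  also have "\<dots> \<le> (\<Sum>xs\<in>permutations_of_set S. fact (card J) * chain_bound I ?h xs w v)"
  proof (rule sum_mono)
    fix xs assume "xs \<in> permutations_of_set S"
    then have xs: "distinct xs" "set xs = S" by (auto simp: permutations_of_set_def)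
    then obtain C where C: "\<And>L. C L \<ge> 0"
        "\<And>h. chain_bound I h xs w v = (\<Sum>L\<in>Pow S. C L * (\<Prod>x\<in>L. h x))"
      using chain_bound_multiaffine[of xs w v I] wv by auto
    have "(\<Sum>\<sigma> | \<sigma> permutes J. chain_bound I (h \<circ> \<sigma>) xs w v)
        = (\<Sum>L\<in>Pow S. C L * (\<Sum>\<sigma> | \<sigma> permutes J. \<Prod>x\<in>L. h (\<sigma> x)))"
      unfolding C sum_distrib_left o_def by (rule sum.swap)
    also have "\<dots> \<le> (\<Sum>L\<in>Pow S. C L * (fact (card J) * (\<Prod>x\<in>L. ?h x)))"
    proof (rule sum_mono, rule mult_left_mono[OF _ C(1)])
      fix L assume "L \<in> Pow S"
      then have L: "L \<subseteq> S" "finite L" using S by (auto intro: finite_subset)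
      have split: "prod g L = prod g (L - J) * prod g (L \<inter> J)" for g :: "'a \<Rightarrow> real"
        using prod.Int_Diff[of L g J] L by (simp add: mult.commute)
      have "(\<Sum>\<sigma> | \<sigma> permutes J. \<Prod>x\<in>L. h (\<sigma> x))
          = (\<Sum>\<sigma> | \<sigma> permutes J. prod h (L - J) * (\<Prod>x\<in>L \<inter> J. h (\<sigma> x)))"
        unfolding split
        by (intro sum.cong refl arg_cong2[where f = "(*)"] prod.cong) (auto simp: permutes_not_in)
      also have "\<dots> \<le> prod h (L - J) * (fact (card J) * (sum h J / card J) ^ card (L \<inter> J))"
        unfolding sum_distrib_left[symmetric] using S L h fJ
        by (intro mult_left_mono sum_permutes_prod_le prod_nonneg) auto
      also have "\<dots> = fact (card J) * (\<Prod>x\<in>L. ?h x)"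
        unfolding split[of ?h] by simp
      finally show "(\<Sum>\<sigma> | \<sigma> permutes J. \<Prod>x\<in>L. h (\<sigma> x)) \<le> fact (card J) * (\<Prod>x\<in>L. ?h x)" .
    qed
    also have "\<dots> = fact (card J) * chain_bound I ?h xs w v"
      unfolding C by (simp add: sum_distrib_left mult_ac)
    finally show "(\<Sum>\<sigma> | \<sigma> permutes J. chain_bound I (h \<circ> \<sigma>) xs w v) \<le> fact (card J) * chain_bound I ?h xs w v" .
  qed
  finally show ?thesis by (simp add: sum_distrib_left[symmetric])
qed

section \<open>Constant entries and the binomial recursion\<close>

text \<open>
  With \<open>g = c / (1 - b)\<close>, summing \<open>chain_bound\<close> over all patterns of \<open>k + 1\<close> entries \<open>c\<close> on \<open>I\<close> and \<open>m\<close>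
  entries \<open>b\<close> off \<open>I\<close> gives at most \<open>binom_poly g k 1 m\<close> from \<open>(w, v) = (1, 0)\<close> and
  \<open>g * binom_poly g k 0 m\<close> from \<open>(0, 1)\<close>.
\<close>

definition binom_poly :: "real \<Rightarrow> nat \<Rightarrow> nat \<Rightarrow> nat \<Rightarrow> real" where
  "binom_poly g k j m = (\<Sum>r\<le>k. real (k choose r) * g ^ r * real ((k + j + m - r) choose m))"

text \<open>Pascal's rule for \<open>k\<close>. After an index of \<open>I\<close> the pair has the
  form \<open>(w, w)\<close>, and this identity merges its two contributions into one
  polynomial.\<close>

lemma binom_poly_Suc:
  "binom_poly g (Suc k) 0 m = binom_poly g k 1 m + g * binom_poly g k 0 m"
proof -
  let ?f = "\<lambda>r. g ^ r * real ((k + 1 + m - r) choose m)"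
  have "binom_poly g (Suc k) 0 m = (\<Sum>r\<le>Suc k. (Suc k choose r) * ?f r)"
    by (simp add: binom_poly_def mult.assoc)
  also have "\<dots> = ?f 0 + (\<Sum>r\<le>k. (Suc k choose Suc r) * ?f (Suc r))"
    by (subst sum.atMost_Suc_shift) simp
  also have "\<dots> = ?f 0 + (\<Sum>r\<le>k. (k choose Suc r) * ?f (Suc r)) + (\<Sum>r\<le>k. (k choose r) * ?f (Suc r))"
    by (simp add: algebra_simps sum.distrib)
  also have "?f 0 + (\<Sum>r\<le>k. (k choose Suc r) * ?f (Suc r)) = (\<Sum>r\<le>Suc k. (k choose r) * ?f r)"
    by (subst sum.atMost_Suc_shift) simp
  also have "\<dots> = binom_poly g k 1 m"
    by (simp add: binom_poly_def mult.assoc)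
  also have "(\<Sum>r\<le>k. (k choose r) * ?f (Suc r)) = g * binom_poly g k 0 m"
    by (simp add: binom_poly_def sum_distrib_left mult_ac)
  finally show ?thesis .
qed

text \<open>Pascal's rule for \<open>m\<close>. In the recursion the first term on the right comes
  from a first index off \<open>I\<close>, the second from a first index in
  \<open>I\<close>.\<close>

lemma binom_poly_pascal:
  "binom_poly g k 1 (Suc m) = binom_poly g k 1 m + binom_poly g k 0 (Suc m)"
proof -
  have "(k + 1 + Suc m - r) choose Suc m = ((k + 1 + m - r) choose m) + ((k + 0 + Suc m - r) choose Suc m)"
    if "r \<le> k" for r
    using that by (simp add: Suc_diff_le)
  then show ?thesis
    unfolding binom_poly_def sum.distrib[symmetric]
    by (intro sum.cong) (auto simp: algebra_simps)
qed

lemma binom_poly_mono: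
  fixes g :: real
  assumes "g \<ge> 0"
  shows "binom_poly g k 0 m \<le> binom_poly g k 0 (Suc m)"
  unfolding binom_poly_def
proof (intro sum_mono mult_left_mono)
  fix r assume "r \<in> {..k}"
  then have "(k + 0 + Suc m - r) choose Suc m = ((k + m - r) choose m) + ((k + m - r) choose Suc m)"
    by (simp add: Suc_diff_le)
  then show "real ((k + 0 + m - r) choose m) \<le> real ((k + 0 + Suc m - r) choose Suc m)" by simp
qed (use assms in auto)

text \<open>When \<open>r\<close> grows by one, the binomial coefficient shrinks by the factor
  \<open>(Suc k - r) / (Suc k + m - r)\<close>, which is at most \<open>Suc k / (Suc k + m)\<close>.
  With all factors replaced by this bound, the sum is the expansion of a \<open>k\<close>-th
  power.\<close>

lemma binom_poly_le:
  fixes g :: real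
  assumes "g \<ge> 0"
  shows "binom_poly g k 1 m
       \<le> real ((Suc k + m) choose m) * (1 + real (Suc k) * g / real (Suc k + m)) ^ k"
proof -
  let ?n = "Suc k + m"
  have choose: "real ((?n - r) choose m) \<le> (?n choose m) * (Suc k / ?n) ^ r" if "r \<le> k" for r
    using that
  proof (induction r)
    case (Suc r)
    \<comment> \<open>Absorption, \<open>N * (N - 1 choose m) = (N - m) * (N choose m)\<close>, at
      \<open>N = ?n - r\<close>, where \<open>N - m = Suc k - r\<close>.\<close>
    have "((?n - Suc r) choose m) * (?n - r) = ((?n - r) choose m) * (Suc k - r)"
    proof -
      have "?n - r = Suc (?n - Suc r)" using Suc.prems by simp
      moreover have "Suc k - r = Suc (?n - Suc r) - m" using Suc.prems by simp
      ultimately show ?thesis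
        using binomial_absorb_comp[of "Suc (?n - Suc r)" m] Suc.prems by (simp add: mult.commute)
    qed
    then have "real ((?n - Suc r) choose m) * real (?n - r) = real ((?n - r) choose m) * real (Suc k - r)"
      unfolding of_nat_mult[symmetric] by simp
    then have "real ((?n - Suc r) choose m) = real ((?n - r) choose m) * (real (Suc k - r) / real (?n - r))"
      using Suc.prems by (simp add: field_simps)
    also have "\<dots> \<le> ((?n choose m) * (Suc k / ?n) ^ r) * (Suc k / ?n)"
    proof (intro mult_mono)
      have "real (Suc k - r) = real (Suc k) - real r" "real (?n - r) = real ?n - real r"
        using Suc.prems by (simp_all add: of_nat_diff)
      moreover have "(real (Suc k) - real r) / (real ?n - real r) \<le> real (Suc k) / real ?n"
        using Suc.prems by (simp add: divide_simps) (simp add: algebra_simps)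
      ultimately show "real (Suc k - r) / real (?n - r) \<le> real (Suc k) / real ?n"
        by (simp only:)
    qed (use Suc in auto)
    finally show ?case by (simp add: mult_ac)
  qed simp
  have "binom_poly g k 1 m = (\<Sum>r\<le>k. real (k choose r) * g ^ r * real ((?n - r) choose m))"
    by (simp add: binom_poly_def)
  also have "\<dots> \<le> (\<Sum>r\<le>k. real (k choose r) * g ^ r *
                          (real (?n choose m) * (real (Suc k) / real ?n) ^ r))"
    using assms choose by (intro sum_mono mult_left_mono) auto
  also have "\<dots> = real (?n choose m) *
                     (\<Sum>r\<le>k. real (k choose r) * (real (Suc k) * g / real ?n) ^ r * 1 ^ (k - r))"
    unfolding sum_distrib_left power_mult_distrib power_divide by (intro sum.cong) simp_all
  also have "\<dots> = real (?n choose m) * (real (Suc k) * g / real ?n + 1) ^ k"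
    by (subst binomial_ring) simp
  finally show ?thesis by (simp add: add.commute)
qed

lemma sum_permutations_of_set_Cons:
  assumes "finite S" "S \<noteq> {}"
  shows "(\<Sum>xs\<in>permutations_of_set S. f xs)
       = (\<Sum>x\<in>S. \<Sum>xs\<in>permutations_of_set (S - {x}). f (x # xs))"
proof -
  have "(\<Sum>xs\<in>permutations_of_set S. f xs)
      = (\<Sum>x\<in>S. \<Sum>xs\<in>(#) x ` permutations_of_set (S - {x}). f xs)"
    unfolding permutations_of_set_nonempty[OF assms(2)]
    using assms by (intro sum.UNION_disjoint) auto
  then show ?thesis by (simp add: sum.reindex)
qed

text \<open>Induction on the number of entries, by the first one. An entry of \<open>A\<close> turns
  \<open>(w, v)\<close> into \<open>(w', w')\<close> with \<open>w' = w + (1 - b) * g * v\<close>,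
  an entry of \<open>B\<close> into \<open>(w, b * v)\<close>. Writing the value on \<open>A\<close>
  as \<open>(1 - b) * g\<close> makes the weights of the two cases in the \<open>v\<close>-part sum
  to one.\<close>

lemma sum_chain_bound_const_le:
  assumes "finite A" "finite B" "A \<inter> B = {}" "A \<subseteq> I" "B \<inter> I = {}"
    and "w \<ge> 0" "v \<ge> 0" "g \<ge> 0" "0 \<le> b" "b \<le> 1"
    and h: "\<And>x. x \<in> A \<Longrightarrow> h x = (1 - b) * g" "\<And>x. x \<in> B \<Longrightarrow> h x = b"
  shows "(\<Sum>xs\<in>permutations_of_set (A \<union> B). chain_bound I h xs w v)
       \<le> fact (card A) * fact (card B) *
          (case card A of 0 \<Rightarrow> w
           | Suc k \<Rightarrow> w * binom_poly g k 1 (card B) + v * (g * binom_poly g k 0 (card B)))"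
  using assms
proof (induction "card A + card B" arbitrary: A B w v)
  case 0
  then show ?case by simp
next
  case (Suc N)
  define bd :: "nat \<Rightarrow> nat \<Rightarrow> real \<Rightarrow> real \<Rightarrow> real" where
    "bd k m w v = (case k of 0 \<Rightarrow> w
       | Suc k \<Rightarrow> w * binom_poly g k 1 m + v * (g * binom_poly g k 0 m))" for k m w v
  \<comment> \<open>Once the two components agree, the bound has the same form whether or not
    further indices of \<open>I\<close> follow.\<close>
  have bd_diag: "bd k m w w = w * binom_poly g k 0 m" for k m w
  proof (cases k)
    case 0
    then show ?thesis by (simp add: bd_def binom_poly_def)
  next
    case (Suc k')
    then show ?thesis by (simp add: bd_def binom_poly_Suc algebra_simps)
  qed
  have ne: "A \<union> B \<noteq> {}" using Suc by auto
  have IH: "(\<Sum>xs\<in>permutations_of_set (A' \<union> B'). chain_bound I h xs w v)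
      \<le> fact (card A') * fact (card B') * bd (card A') (card B') w v"
    if "N = card A' + card B'" "A' \<subseteq> A" "B' \<subseteq> B" "w \<ge> 0" "v \<ge> 0" for A' B' w v
    unfolding bd_def using that Suc.prems
    by (intro Suc.hyps(1)) (auto intro: finite_subset)
  have sA: "(\<Sum>xs\<in>permutations_of_set (A \<union> B - {x}). chain_bound I h (x # xs) w v)
      \<le> fact (card A - 1) * fact (card B) * ((w + (1 - b) * g * v) * binom_poly g (card A - 1) 0 (card B))"
    if x: "x \<in> A" for x
  proof -
    have "A \<union> B - {x} = (A - {x}) \<union> B" using x Suc.prems by blast
    moreover have "x \<in> I" using x Suc.prems by blast
    moreover have c: "card (A - {x}) = card A - 1" "card A > 0"
      using x Suc.prems by (auto simp: card_gt_0_iff)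
    moreover have "0 \<le> w + (1 - b) * g * v" using Suc.prems by simp
    ultimately show ?thesis
      using IH[of "A - {x}" B "w + (1 - b) * g * v" "w + (1 - b) * g * v"] Suc.hyps(2) Suc.prems(11)[OF x]
      by (simp add: bd_diag Diff_subset)
  qed
  have sB: "(\<Sum>xs\<in>permutations_of_set (A \<union> B - {x}). chain_bound I h (x # xs) w v)
      \<le> fact (card A) * fact (card B - 1) * bd (card A) (card B - 1) w (b * v)"
    if x: "x \<in> B" for x
  proof -
    have "A \<union> B - {x} = A \<union> (B - {x})" using x Suc.prems by blast
    moreover have "x \<notin> I" using x Suc.prems by blast
    moreover have c: "card (B - {x}) = card B - 1" "card B > 0"
      using x Suc.prems by (auto simp: card_gt_0_iff)
    ultimately show ?thesis
      using IH[of A "B - {x}" w "b * v"] Suc.hyps(2) Suc.prems(6,7,9) Suc.prems(12)[OF x]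
      by (simp add: Diff_subset)
  qed
  have "(\<Sum>xs\<in>permutations_of_set (A \<union> B). chain_bound I h xs w v)
      = (\<Sum>x\<in>A. \<Sum>xs\<in>permutations_of_set (A \<union> B - {x}). chain_bound I h (x # xs) w v)
      + (\<Sum>x\<in>B. \<Sum>xs\<in>permutations_of_set (A \<union> B - {x}). chain_bound I h (x # xs) w v)"
    using Suc.prems ne by (subst sum_permutations_of_set_Cons) (auto intro: sum.union_disjoint)
  also have "\<dots> \<le> (\<Sum>x\<in>A. fact (card A - 1) * fact (card B) *
                     ((w + (1 - b) * g * v) * binom_poly g (card A - 1) 0 (card B)))
      + (\<Sum>x\<in>B. fact (card A) * fact (card B - 1) * bd (card A) (card B - 1) w (b * v))"
    by (intro add_mono sum_mono sA sB)
  also have "\<dots> \<le> fact (card A) * fact (card B) * bd (card A) (card B) w v"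
  proof -
    let ?a = "(w + (1 - b) * g * v) * binom_poly g (card A - 1) 0 (card B)"
    let ?b = "bd (card A) (card B - 1) w (b * v)"
    \<comment> \<open>The choices of the first entry restore the factorial. For \<open>m = 0\<close>
      truncated subtraction gives \<open>fact 0\<close>, and the factor \<open>m\<close> removes
      this case.\<close>
    have fact: "real m * fact (m - 1) = (if m = 0 then 0 else fact m)" for m
      by (cases m) simp_all
    have "(\<Sum>x\<in>A. fact (card A - 1) * fact (card B) * ?a) + (\<Sum>x\<in>B. fact (card A) * fact (card B - 1) * ?b)
      = (real (card A) * fact (card A - 1)) * fact (card B) * ?a
      + fact (card A) * (real (card B) * fact (card B - 1)) * ?b"
      by simp
    also have "\<dots> = fact (card A) * fact (card B) *
        ((if card A = 0 then 0 else ?a) + (if card B = 0 then 0 else ?b))"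
      unfolding fact by (simp add: algebra_simps)
    also have "(if card A = 0 then 0 else ?a) + (if card B = 0 then 0 else ?b) \<le> bd (card A) (card B) w v"
    proof (cases "card A")
      case 0
      then show ?thesis using Suc.prems by (simp add: bd_def)
    next
      case k: (Suc k)
      show ?thesis
      proof (cases "card B")
        case 0
        have "binom_poly g k 1 0 = binom_poly g k 0 0" by (simp add: binom_poly_def)
        moreover have "binom_poly g k 0 0 \<ge> 0"
          using Suc.prems by (auto simp: binom_poly_def intro!: sum_nonneg)
        then have "(1 - b) * (g * v * binom_poly g k 0 0) \<le> 1 * (g * v * binom_poly g k 0 0)"
          using Suc.prems by (intro mult_right_mono) auto
        ultimately show ?thesis using k 0 by (simp add: bd_def algebra_simps)
      next
        case m: (Suc m)
        \<comment> \<open>The \<open>w\<close>-part matches exactly by Pascal's rule; the only loss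
          is this enlargement of \<open>m\<close> to \<open>Suc m\<close> in the
          \<open>v\<close>-part.\<close>
        have "b * (g * v * binom_poly g k 0 m) \<le> b * (g * v * binom_poly g k 0 (Suc m))"
          using binom_poly_mono[of g k m] Suc.prems by (intro mult_left_mono) auto
        then show ?thesis
          using k m binom_poly_pascal[of g k m] by (simp add: bd_def algebra_simps)
      qed
    qed
    finally show ?thesis by (simp add: mult_left_mono)
  qed
  finally show ?case by (simp add: bd_def)
qed

text \<open>Symmetrizing first off \<open>I\<close> and then on \<open>I\<close> makes
  \<open>h\<close> constant on both sets, where the recursion applies. The two factorials and the
  binomial coefficient from \<open>binom_poly_le\<close> combine to
  \<open>fact (card S)\<close>.\<close>

lemma sum_permutations_chain_bound_le:
  fixes h :: "'a \<Rightarrow> real" and a :: real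
  assumes S: "finite S" and I: "I \<subseteq> S" "I \<noteq> {}" and J: "S - I \<noteq> {}"
    and h: "\<And>x. x \<in> S \<Longrightarrow> h x \<ge> 0" and a: "sum h (S - I) / card (S - I) = 1 - a" "0 < a"
  shows "(\<Sum>xs\<in>permutations_of_set S. chain_bound I h xs 1 0)
    \<le> fact (card S) * (1 + sum h I / (card S * a)) ^ (card I - 1)"
proof -
  have fin: "finite I" "finite (S - I)" using S I finite_subset by auto
  define h1 where "h1 x = (if x \<in> S - I then 1 - a else h x)" for x
  define h2 where "h2 x = (if x \<in> I then sum h I / card I else h1 x)" for x
  have "0 \<le> sum h (S - I) / card (S - I)" using h by (intro divide_nonneg_nonneg sum_nonneg) auto
  with a have a1: "0 \<le> 1 - a" by simp
  \<comment> \<open>The mean of \<open>h\<close> on \<open>I\<close> is then \<open>a * g\<close>,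
    which is \<open>(1 - b) * g\<close> for \<open>b = 1 - a\<close>.\<close>
  define g where "g = sum h I / card I / a"
  have g: "0 \<le> g" unfolding g_def using h I a by (intro divide_nonneg_nonneg sum_nonneg) auto
  obtain k where k: "card I = Suc k" using I fin by (metis card_gt_0_iff gr0_implies_Suc)
  let ?m = "card (S - I)"
  have n: "card S = Suc k + ?m"
    using card_Diff_subset[OF fin(1) I(1)] card_mono[OF S I(1)] k by simp
  have "(\<Sum>xs\<in>permutations_of_set S. chain_bound I h xs 1 0) \<le> (\<Sum>xs\<in>permutations_of_set S. chain_bound I h1 xs 1 0)"
    unfolding h1_def[abs_def]
    by (rule sum_chain_bound_symmetrize[OF S Diff_subset J, where h = h, unfolded a(1)]) (use h in auto)
  also have "\<dots> \<le> (\<Sum>xs\<in>permutations_of_set S. chain_bound I h2 xs 1 0)"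
  proof -
    have eq: "sum h I = sum h1 I" by (intro sum.cong) (auto simp: h1_def)
    show ?thesis
      unfolding h2_def[abs_def] eq
      by (rule sum_chain_bound_symmetrize[OF S I]) (use h a1 in \<open>auto simp: h1_def\<close>)
  qed
  also have "\<dots> = (\<Sum>xs\<in>permutations_of_set (I \<union> (S - I)). chain_bound I h2 xs 1 0)"
    using I by (simp add: Un_absorb1)
  also have "\<dots> \<le> fact (card I) * fact ?m * (case card I of 0 \<Rightarrow> 1
           | Suc k \<Rightarrow> 1 * binom_poly g k 1 ?m + 0 * (g * binom_poly g k 0 ?m))"
    using fin g a a1 by (intro sum_chain_bound_const_le[where b = "1 - a"]) (auto simp: h2_def h1_def g_def)
  also have "\<dots> = fact (Suc k) * fact ?m * binom_poly g k 1 ?m" using k by simp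
  also have "\<dots> \<le> fact (Suc k) * fact ?m *
      (real ((Suc k + ?m) choose ?m) * (1 + real (Suc k) * g / real (Suc k + ?m)) ^ k)"
    by (intro mult_left_mono binom_poly_le g) simp_all
  also have "\<dots> = fact (card S) * (1 + real (Suc k) * g / real (card S)) ^ k"
  proof -
    have "real ((Suc k + ?m) choose ?m) = fact (Suc k + ?m) / (fact ?m * fact (Suc k))"
      using binomial_fact[of ?m "Suc k + ?m", where 'a = real] by (simp del: fact_Suc)
    then show ?thesis unfolding n by (simp del: fact_Suc binomial_Suc_Suc)
  qed
  also have "real (Suc k) * g / real (card S) = sum h I / (card S * a)"
    using k by (simp add: g_def mult_ac)
  finally show ?thesis using k by simp
qed

section \<open>The linear part of the chain bound\<close>

text \<open>The part of \<open>chain_bound\<close> that is linear in the values of \<open>h\<close> on \<open>I\<close>.\<close>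

fun penalty :: "'a set \<Rightarrow> ('a \<Rightarrow> real) \<Rightarrow> 'a list \<Rightarrow> real \<Rightarrow> real \<Rightarrow> real" where
  "penalty I h [] w v = 0"
| "penalty I h (x # xs) w v =
     (if x \<in> I then h x * v + penalty I h xs w w else penalty I h xs w (h x * v))"

lemma penalty_linear:
  "penalty I h xs (r * w + r' * w') (r * v + r' * v')
     = r * penalty I h xs w v + r' * penalty I h xs w' v'"
proof (induction xs arbitrary: w v w' v')
  case (Cons x xs)
  have "h x * (r * v + r' * v') = r * (h x * v) + r' * (h x * v')"
    by (simp add: algebra_simps)
  then show ?case
    by (simp only: penalty.simps Cons.IH split: if_split) (simp add: algebra_simps)
qed simp

lemma penalty_mono:
  assumes "\<And>x. x \<in> set xs \<Longrightarrow> h x \<ge> 0" "w \<le> w'" "v \<le> v'"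
  shows "penalty I h xs w v \<le> penalty I h xs w' v'"
  using assms
proof (induction xs arbitrary: w v w' v')
  case (Cons x xs)
  then have "h x * v \<le> h x * v'" by (intro mult_left_mono) auto
  with Cons show ?case by (auto intro!: Cons.IH add_mono)
qed simp

lemma penalty_zero: "penalty I h xs 0 0 = 0"
  by (induction xs) auto

lemma penalty_nonneg:
  assumes "\<And>x. x \<in> set xs \<Longrightarrow> h x \<ge> 0" "0 \<le> w" "0 \<le> v"
  shows "0 \<le> penalty I h xs w v"
  using penalty_mono[of xs h 0 w 0 v I] assms by (simp add: penalty_zero)

text \<open>The left side is the right side truncated at first order in \<open>e\<close>; the
  omitted terms are nonnegative.\<close>

lemma penalty_le_chain_bound:
  assumes "\<And>x. x \<in> set xs \<Longrightarrow> h x \<ge> 0" "0 \<le> w" "0 \<le> v" "0 \<le> e"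
  shows "w + e * penalty I h xs w v \<le> chain_bound I (\<lambda>x. if x \<in> I then e * h x else h x) xs w v"
  using assms
proof (induction xs arbitrary: w v)
  case (Cons x xs)
  show ?case
  proof (cases "x \<in> I")
    case True
    let ?w = "w + e * h x * v"
    have "0 \<le> e * h x * v" using Cons.prems by simp
    then have "e * penalty I h xs w w \<le> e * penalty I h xs ?w ?w"
      using Cons.prems by (intro mult_left_mono penalty_mono) auto
    moreover have "?w + e * penalty I h xs ?w ?w
        \<le> chain_bound I (\<lambda>x. if x \<in> I then e * h x else h x) xs ?w ?w"
      using Cons.prems by (intro Cons.IH) auto
    ultimately show ?thesis using True by (simp add: algebra_simps)
  next
    case False
    then show ?thesis using Cons.IH[of w "h x * v"] Cons.prems by simp
  qed
qed simp

lemma sum_permutations_penalty_le: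
  fixes h :: "'a \<Rightarrow> real" and a :: real
  assumes S: "finite S" and I: "I \<subseteq> S" "I \<noteq> {}" and J: "S - I \<noteq> {}"
    and h: "\<And>x. x \<in> S \<Longrightarrow> h x \<ge> 0" and a: "sum h (S - I) / card (S - I) = 1 - a" "0 < a"
  shows "(\<Sum>xs\<in>permutations_of_set S. penalty I h xs 1 0)
    \<le> fact (card S) * (real (card I - 1) * (sum h I / (card S * a)))"
proof -
  txt \<open>
    Scaling \<open>h\<close> by \<open>e\<close> on \<open>I\<close> in the bound for \<open>chain_bound\<close> and letting \<open>e\<close> tend to \<open>0\<close> extracts the
    linear part.
  \<close>
  let ?y = "sum h I / (card S * a)" and ?k = "card I - 1"
  let ?D = "\<Sum>xs\<in>permutations_of_set S. penalty I h xs 1 0"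
  let ?f = "\<lambda>e. (1 + e * ?y) ^ ?k"
  have bound: "?D / fact (card S) \<le> (?f e - 1) / e" if e: "0 < e" for e
  proof -
    let ?h = "\<lambda>x. if x \<in> I then e * h x else h x"
    have "fact (card S) + e * ?D = (\<Sum>xs\<in>permutations_of_set S. 1 + e * penalty I h xs 1 0)"
      using S by (simp add: sum.distrib sum_distrib_left)
    also have "\<dots> \<le> (\<Sum>xs\<in>permutations_of_set S. chain_bound I ?h xs 1 0)"
      using h e by (intro sum_mono penalty_le_chain_bound) (auto simp: permutations_of_set_def)
    also have "\<dots> \<le> fact (card S) * (1 + sum ?h I / (card S * a)) ^ ?k"
    proof (intro sum_permutations_chain_bound_le S I J)
      have "sum ?h (S - I) = sum h (S - I)" by (intro sum.cong) auto
      with a show "sum ?h (S - I) / card (S - I) = 1 - a" by simp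
    qed (use h e a in auto)
    also have "sum ?h I = e * sum h I"
      unfolding sum_distrib_left by (intro sum.cong) auto
    finally have le: "fact (card S) + e * ?D \<le> fact (card S) * ?f e"
      by (simp only: times_divide_eq_right)
    have "D / F \<le> (c - 1) / e" if "F + e * D \<le> F * c" "0 < F" for D F c :: real
      using that e by (simp add: field_simps)
    from this[OF le fact_gt_zero] show ?thesis .
  qed
  have "((\<lambda>e. ((1 + e * y) ^ k - 1) / e) \<longlongrightarrow> real k * y) (at_right 0)" for y :: real and k
  proof -
    have "((\<lambda>e. (1 + e * y) ^ k) has_real_derivative real k * y) (at 0)"
      by (auto intro!: derivative_eq_intros)
    then have "((\<lambda>e. ((1 + e * y) ^ k - 1) / e) \<longlongrightarrow> real k * y) (at 0)"
      by (simp add: DERIV_def)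
    then show ?thesis by (rule tendsto_within_subset) simp
  qed
  then have "((\<lambda>e. (?f e - 1) / e) \<longlongrightarrow> real ?k * ?y) (at_right 0)" .
  moreover have "\<forall>\<^sub>F e in at_right 0. ?D / fact (card S) \<le> (?f e - 1) / e"
    using bound by (auto simp: eventually_at_filter)
  ultimately have "?D / fact (card S) \<le> real ?k * ?y"
    by (rule tendsto_lowerbound) simp
  then show ?thesis by (simp only: pos_divide_le_eq[OF fact_gt_zero] mult.commute)
qed

section \<open>One step of the loop\<close>

text \<open>If \<open>x + p \<le> 1\<close>, one new entry is 0, so the covariance is
  \<open>- x * p\<close>; otherwise one is 1 and the covariance is
  \<open>- (1 - x) * (1 - p)\<close>. The condition on \<open>x + p\<close> bounds its size by
  \<open>x * (1 - x)\<close> in both cases. For the first entry the mean of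
  \<open>a * (1 - a)\<close> falls to at most \<open>1 - p\<close> times \<open>x * (1 - x)\<close>
  in the first case and \<open>p\<close> times it in the second.\<close>

lemma simplify_cases:
  assumes "x \<in> {0<..<1}" "p \<in> {0<..<1}"
  obtains r a1 b1 a2 b2 :: real where
    "0 \<le> r" "r \<le> 1"
    "simplify x p = map_pmf (\<lambda>c. if c then (a1, b1) else (a2, b2)) (bernoulli_pmf r)"
    "{a1, b1, a2, b2} \<subseteq> {0..1}"
    "a1 \<notin> {0<..<1} \<or> b1 \<notin> {0<..<1}" "a2 \<notin> {0<..<1} \<or> b2 \<notin> {0<..<1}"
    "r * a1 + (1 - r) * a2 = x" "r * b1 + (1 - r) * b2 = p"
    "\<bar>r * (a1 * b1) + (1 - r) * (a2 * b2) - x * p\<bar> \<le> x * (1 - x)"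
    "r * (a1 * (1 - a1)) + (1 - r) * (a2 * (1 - a2)) \<le> (1 - min p (1 - p)) * (x * (1 - x))"
proof (cases "x + p \<le> 1")
  case True
  let ?r = "p / (x + p)"
  have r: "(1 - ?r) * (x + p) = x" using assms by (simp add: field_simps)
  have "1 - ?r = x / (x + p)" using assms by (simp add: field_simps)
  show ?thesis
  proof (rule that[of ?r 0 "x + p" "x + p" 0])
    show "\<bar>?r * (0 * (x + p)) + (1 - ?r) * ((x + p) * 0) - x * p\<bar> \<le> x * (1 - x)"
      using assms True by (simp add: abs_if mult_left_mono)
    have "?r * (0 * (1 - 0)) + (1 - ?r) * ((x + p) * (1 - (x + p))) = x * (1 - (x + p))"
      using r by (simp add: mult.assoc[symmetric])
    also have "\<dots> \<le> x * ((1 - x) * (1 - p))"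
      using assms by (intro mult_left_mono) (auto simp: algebra_simps)
    also have "\<dots> \<le> x * ((1 - x) * (1 - min p (1 - p)))"
      using assms by (intro mult_left_mono) auto
    finally show "?r * (0 * (1 - 0)) + (1 - ?r) * ((x + p) * (1 - (x + p)))
        \<le> (1 - min p (1 - p)) * (x * (1 - x))" by (simp add: mult_ac)
  qed (use assms True r in \<open>auto simp: simplify_def\<close>)
next
  case False
  define r where "r = (1 - p) / ((1 - x) + (1 - p))"
  let ?y = "x + p - 1"
  have pos: "(1 - x) + (1 - p) > 0" using assms by auto
  have r': "1 - r = (1 - x) / (1 - ?y)" using pos by (simp add: r_def field_simps)
  have "1 - ?y > 0" using pos by simp
  then have r: "(1 - r) * (1 - ?y) = 1 - x" unfolding r' by (simp add: field_simps)
  have r1: "r * (1 - ?y) = 1 - p" using pos by (simp add: r_def field_simps)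
  show ?thesis
  proof (rule that[of r 1 ?y ?y 1])
    show e1: "r * 1 + (1 - r) * ?y = x" using r by (simp add: algebra_simps)
    show e2: "r * ?y + (1 - r) * 1 = p" using r1 by (simp add: algebra_simps)
    have "r * (1 * ?y) + (1 - r) * (?y * 1) - x * p = - ((1 - x) * (1 - p))"
      by (simp add: algebra_simps)
    moreover have "(1 - x) * (1 - p) \<le> (1 - x) * x"
      using assms False by (intro mult_left_mono) auto
    moreover have "(1 - x) * (1 - p) \<ge> 0" using assms by simp
    ultimately show "\<bar>r * (1 * ?y) + (1 - r) * (?y * 1) - x * p\<bar> \<le> x * (1 - x)"
      by (simp only: abs_minus abs_of_nonneg mult.commute)
    have "r * (1 * (1 - 1)) + (1 - r) * (?y * (1 - ?y)) = ?y * (1 - x)"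
      using r by (simp add: mult.left_commute)
    also have "\<dots> \<le> (p * x) * (1 - x)"
    proof (intro mult_right_mono)
      have "0 \<le> (1 - x) * (1 - p)" using assms by simp
      then show "?y \<le> p * x" by (simp add: algebra_simps)
    qed (use assms in auto)
    also have "\<dots> = p * (x * (1 - x))" by simp
    also have "\<dots> \<le> (1 - min p (1 - p)) * (x * (1 - x))"
      using assms by (intro mult_right_mono) auto
    finally show "r * (1 * (1 - 1)) + (1 - r) * (?y * (1 - ?y))
        \<le> (1 - min p (1 - p)) * (x * (1 - x))" .
  qed (use assms False pos in \<open>auto simp: simplify_def r_def\<close>)
qed

text \<open>Finite support allows the expectation of any real function to be expanded as a finite
  sum.\<close>

lemma finite_set_pmf_dep_round_loop: "finite (set_pmf (dep_round_loop n \<pi> X))"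
proof (induction n \<pi> X rule: dep_round_loop.induct)
  case (1 n \<pi> X)
  have fin: "finite (set_pmf (simplify a b))" for a b
    by (auto simp: simplify_def)
  show ?case
  proof (cases "2 \<le> card (fractional n X)")
    case True
    show ?thesis
      using True 1[OF True refl refl] fin
      by (subst dep_round_loop.simps) (simp add: Let_def del: fun_upd_apply)
  next
    case False
    then show ?thesis by (subst dep_round_loop.simps) simp
  qed
qed

lemma expectation_bind_bernoulli:
  fixes h :: "'a \<Rightarrow> real"
  assumes "0 \<le> r" "r \<le> 1" "finite (set_pmf (f True))" "finite (set_pmf (f False))"
  shows "measure_pmf.expectation (bernoulli_pmf r \<bind> f) h
       = r * measure_pmf.expectation (f True) h + (1 - r) * measure_pmf.expectation (f False) h"
proof -
  have "finite (set_pmf (f c))" for c using assms by (cases c) auto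
  then have "measure_pmf.expectation (bernoulli_pmf r \<bind> f) h
      = (\<Sum>c\<in>UNIV. pmf (bernoulli_pmf r) c *\<^sub>R measure_pmf.expectation (f c) h)"
    by (intro pmf_expectation_bind) auto
  then show ?thesis using assms by (simp add: UNIV_bool)
qed

lemma arg_min_on_eqI:
  fixes f :: "'a \<Rightarrow> nat"
  assumes "finite S" "c \<in> S" "\<And>y. y \<in> S \<Longrightarrow> y \<noteq> c \<Longrightarrow> f c < f y"
  shows "arg_min_on f S = c"
  using arg_min_if_finite[of S f] assms by (metis empty_iff)

section \<open>Literals, the carrier and the progress of the loop\<close>

definition literal :: "nat set \<Rightarrow> (nat \<Rightarrow> real) \<Rightarrow> nat \<Rightarrow> real" where
  "literal P X i = (if i \<in> P then X i else 1 - X i)"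

definition literal_prod :: "nat set \<Rightarrow> nat set \<Rightarrow> (nat \<Rightarrow> real) \<Rightarrow> real" where
  "literal_prod I P X = (\<Prod>i\<in>I. literal P X i)"

text \<open>With \<open>literal_prod\<close> as W, this is V. Writing it as a sum avoids naming the
  carrier: under \<open>loop_state\<close> there is at most one term, and none if no carrier lies in
  \<open>I\<close>.\<close>

definition carried :: "nat \<Rightarrow> nat set \<Rightarrow> nat set \<Rightarrow> (nat \<Rightarrow> real) \<Rightarrow> nat list \<Rightarrow> real" where
  "carried n I P X xs =
     literal_prod I P X * (\<Sum>c\<in>(fractional n X - set xs) \<inter> I. 1 - literal P X c)"

text \<open>\<open>xs\<close> lists the indices not yet visited, in the order of \<open>\<pi>\<close>.\<close>

definition loop_state :: "nat \<Rightarrow> (nat \<Rightarrow> nat) \<Rightarrow> (nat \<Rightarrow> real) \<Rightarrow> nat list \<Rightarrow> bool" where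
  "loop_state n \<pi> X xs \<longleftrightarrow>
     (\<forall>i\<in>{1..n}. X i \<in> {0..1}) \<and> sorted_wrt (\<lambda>i j. \<pi> i < \<pi> j) xs \<and> set xs \<subseteq> {1..n} \<and>
     card (fractional n X - set xs) \<le> 1 \<and>
     (\<forall>c\<in>fractional n X - set xs. \<forall>x\<in>set xs. \<pi> c < \<pi> x)"

lemma literal_bounds:
  assumes "X i \<in> {0..1}"
  shows "literal P X i \<in> {0..1}"
  using assms by (auto simp: literal_def)

lemma literal_prod_bounds:
  assumes "I \<subseteq> {1..n}" "\<forall>i\<in>{1..n}. X i \<in> {0..1}"
  shows "literal_prod I P X \<in> {0..1}"
proof -
  have "literal P X i \<in> {0..1}" if "i \<in> I" for i
    using assms that by (intro literal_bounds) blast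
  then show ?thesis
    unfolding literal_prod_def by (auto intro!: prod_nonneg prod_le_1)
qed

text \<open>The formula also covers a \<open>c\<close> that has become integral: its literal is then
  0 or 1, so for \<open>c\<close> in \<open>I\<close> the product
  \<open>literal_prod I P X * (1 - literal P X c)\<close> vanishes.\<close>

lemma carried_eq:
  assumes I: "I \<subseteq> {1..n}" and c: "fractional n X - set xs \<subseteq> {c}" "X c \<in> {0..1}" "c \<notin> set xs"
  shows "carried n I P X xs = (if c \<in> I then literal_prod I P X * (1 - literal P X c) else 0)"
proof (cases "c \<in> fractional n X - set xs")
  case True
  then have "fractional n X - set xs = {c}" using c by blast
  then show ?thesis by (auto simp: carried_def)
next
  case False
  then have e: "fractional n X - set xs = {}" and f: "c \<notin> fractional n X" using c by blast+
  have fI: "finite I" using I finite_subset by blast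
  have "literal_prod I P X * (1 - literal P X c) = 0" if "c \<in> I"
  proof -
    have "X c = 0 \<or> X c = 1" using f that I c by (auto simp: fractional_def)
    then have "literal P X c = 0 \<or> literal P X c = 1" by (auto simp: literal_def)
    moreover have "literal_prod I P X = literal P X c * (\<Prod>i\<in>I - {c}. literal P X i)"
      unfolding literal_prod_def using fI that by (rule prod.remove)
    ultimately show ?thesis by auto
  qed
  moreover have "carried n I P X xs = 0" unfolding carried_def e by simp
  ultimately show ?thesis by simp
qed

lemma carried_bounds:
  assumes "I \<subseteq> {1..n}" "loop_state n \<pi> X xs"
  shows "0 \<le> carried n I P X xs" "carried n I P X xs \<le> literal_prod I P X"
proof -
  have X: "\<forall>i\<in>{1..n}. X i \<in> {0..1}" and card: "card (fractional n X - set xs) \<le> 1"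
    using assms by (auto simp: loop_state_def)
  have l: "literal P X c \<in> {0..1}" if "c \<in> fractional n X" for c
    using that X by (intro literal_bounds) (auto simp: fractional_def)
  let ?s = "\<Sum>c\<in>(fractional n X - set xs) \<inter> I. 1 - literal P X c"
  have "?s \<ge> 0" using l by (intro sum_nonneg) auto
  moreover have "?s \<le> of_nat (card ((fractional n X - set xs) \<inter> I)) * 1"
    using l by (intro sum_bounded_above) auto
  moreover have "card ((fractional n X - set xs) \<inter> I) \<le> card (fractional n X - set xs)"
    by (intro card_mono) auto
  ultimately have "?s \<in> {0..1}" using card by auto
  moreover have "literal_prod I P X \<in> {0..1}" using literal_prod_bounds assms X by blast
  ultimately show "0 \<le> carried n I P X xs" "carried n I P X xs \<le> literal_prod I P X"
    by (auto simp: carried_def intro: mult_left_le)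
qed

text \<open>The carrier precedes all unvisited indices and \<open>x\<close> is the first of these,
  so \<open>c\<close> and \<open>x\<close> are the two indices that the loop picks.\<close>

lemma loop_unfold:
  assumes st: "loop_state n \<pi> X (x # xs)" and x: "x \<in> fractional n X"
    and c: "fractional n X - set (x # xs) = {c}"
  shows "dep_round_loop n \<pi> X
       = simplify (X c) (X x) \<bind> (\<lambda>\<gamma>. dep_round_loop n \<pi> (X(c := fst \<gamma>, x := snd \<gamma>)))"
proof -
  have cF: "c \<in> fractional n X" and cx: "c \<noteq> x" using c by auto
  have lt: "\<pi> c < \<pi> y" if "y \<in> fractional n X" "y \<noteq> c" for y
    using st c that unfolding loop_state_def by blast
  have lt': "\<pi> x < \<pi> y" if "y \<in> fractional n X" "y \<noteq> c" "y \<noteq> x" for y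
  proof -
    have "y \<in> set xs" using c that by auto
    then show ?thesis using st by (auto simp: loop_state_def)
  qed
  have i: "arg_min_on \<pi> (fractional n X) = c"
    using cF lt by (intro arg_min_on_eqI) auto
  have j: "arg_min_on \<pi> (fractional n X - {c}) = x"
    using x cx lt' by (intro arg_min_on_eqI) auto
  have "card {c, x} \<le> card (fractional n X)"
    using cF x by (intro card_mono) auto
  then show ?thesis
    using cx by (subst dep_round_loop.simps) (simp add: Let_def i j)
qed

lemma literal_prod_upd:
  assumes "finite I" "c \<noteq> x"
  shows "literal_prod I P (X(c := a, x := b)) =
     (if c \<in> I then literal P (\<lambda>_. a) c else 1) * (if x \<in> I then literal P (\<lambda>_. b) x else 1) *
     (\<Prod>i\<in>I - {c, x}. literal P X i)"
proof -
  let ?Y = "X(c := a, x := b)"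
  have "literal_prod I P ?Y = prod (literal P ?Y) (I \<inter> {c, x}) * prod (literal P ?Y) (I - {c, x})"
    unfolding literal_prod_def by (rule prod.Int_Diff[OF assms(1)])
  also have "prod (literal P ?Y) (I - {c, x}) = prod (literal P X) (I - {c, x})"
    by (intro prod.cong) (auto simp: literal_def)
  also have "prod (literal P ?Y) (I \<inter> {c, x}) =
     (if c \<in> I then literal P (\<lambda>_. a) c else 1) * (if x \<in> I then literal P (\<lambda>_. b) x else 1)"
    using assms(2) by (auto simp: literal_def Int_insert_right)
  finally show ?thesis .
qed

text \<open>Visiting \<open>x\<close> triggers an iteration of the loop only if \<open>x\<close> is
  fractional and a carrier exists. Otherwise the vector stays as it is, and the step is the trivial
  mixture with \<open>r = 1\<close>.\<close>

lemma loop_step: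
  assumes st: "loop_state n \<pi> X (x # xs)" and I: "I \<subseteq> {1..n}"
  obtains r X1 X2 where
    "0 \<le> r" "r \<le> 1" "loop_state n \<pi> X1 xs" "loop_state n \<pi> X2 xs"
    "\<forall>y\<in>set xs. X1 y = X y \<and> X2 y = X y"
    "\<forall>f::(nat \<Rightarrow> real) \<Rightarrow> real. measure_pmf.expectation (dep_round_loop n \<pi> X) f
        = r * measure_pmf.expectation (dep_round_loop n \<pi> X1) f
        + (1 - r) * measure_pmf.expectation (dep_round_loop n \<pi> X2) f"
    "x \<in> I \<longrightarrow> literal P X x > 0 \<longrightarrow>
      \<bar>r * literal_prod I P X1 + (1 - r) * literal_prod I P X2 - literal_prod I P X\<bar>
        \<le> 1 / literal P X x * carried n I P X (x # xs)"
    "x \<notin> I \<longrightarrow> r * literal_prod I P X1 + (1 - r) * literal_prod I P X2 = literal_prod I P X"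
    "x \<notin> I \<longrightarrow> r * carried n I P X1 xs + (1 - r) * carried n I P X2 xs
        \<le> (1 - min (X x) (1 - X x)) * carried n I P X (x # xs)"
proof -
  have X: "\<forall>i\<in>{1..n}. X i \<in> {0..1}" and xn: "x \<in> {1..n}" and x_xs: "x \<notin> set xs"
    and sorted: "sorted_wrt (\<lambda>i j. \<pi> i < \<pi> j) xs" and xs: "set xs \<subseteq> {1..n}"
    and x_lt: "\<And>y. y \<in> set xs \<Longrightarrow> \<pi> x < \<pi> y"
    and card: "card (fractional n X - set (x # xs)) \<le> 1"
    and c_lt: "\<And>c y. c \<in> fractional n X - set (x # xs) \<Longrightarrow> y \<in> set xs \<Longrightarrow> \<pi> c < \<pi> y"
    using st by (auto simp: loop_state_def)
  have fI: "finite I" using I finite_subset by blast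
  show ?thesis
  proof (cases "x \<in> fractional n X")
    case False
    then have eq: "fractional n X - set xs = fractional n X - set (x # xs)" by auto
    have "loop_state n \<pi> X xs"
      unfolding loop_state_def eq using X sorted xs card c_lt by blast
    moreover have "carried n I P X xs = carried n I P X (x # xs)"
      by (simp only: carried_def eq)
    \<comment> \<open>An integral entry has decay factor 1, which matches the unchanged
      \<open>carried\<close>.\<close>
    moreover have "min (X x) (1 - X x) = 0"
      using False bspec[OF X xn] xn by (auto simp: fractional_def)
    ultimately show ?thesis
      using carried_bounds(1)[OF I st, of P] by (intro that[of 1 X X]) simp_all
  next
    case xF: True
    show ?thesis
    proof (cases "card (fractional n X - set (x # xs)) = 0")
      case True
      then have empty: "fractional n X - set (x # xs) = {}" by simp
      \<comment> \<open>Here \<open>x\<close> itself becomes the carrier.\<close>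
      then have eq: "fractional n X - set xs = {x}" using x_xs xF by auto
      have "loop_state n \<pi> X xs"
        unfolding loop_state_def eq using X sorted xs x_lt by simp
      moreover have "carried n I P X (x # xs) = 0"
        unfolding carried_def empty by simp
      moreover have "carried n I P X xs = 0" if "x \<notin> I"
        using that unfolding carried_def eq by simp
      ultimately show ?thesis
        by (intro that[of 1 X X]) simp_all
    next
      case False
      with card have "card (fractional n X - set (x # xs)) = 1" by linarith
      then obtain c where "fractional n X - set (x # xs) = {c}" by (rule card_1_singletonE)
      note 3 = xF this
      have cx: "c \<noteq> x" and c_xs: "c \<notin> set xs" and cF: "c \<in> fractional n X" and cn: "c \<in> {1..n}"
        using 3 by (auto simp: fractional_def)
      have frac: "X c \<in> {0<..<1}" "X x \<in> {0<..<1}" using cF 3(1) by (auto simp: fractional_def)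
      obtain r a1 b1 a2 b2 where r: "0 \<le> r" "r \<le> 1"
        and simp_eq: "simplify (X c) (X x) = map_pmf (\<lambda>c. if c then (a1, b1) else (a2, b2)) (bernoulli_pmf r)"
        and range: "{a1, b1, a2, b2} \<subseteq> {0..1}"
        and nf: "a1 \<notin> {0<..<1} \<or> b1 \<notin> {0<..<1}" "a2 \<notin> {0<..<1} \<or> b2 \<notin> {0<..<1}"
        and mean_a: "r * a1 + (1 - r) * a2 = X c" and mean_b: "r * b1 + (1 - r) * b2 = X x"
        and cov: "\<bar>r * (a1 * b1) + (1 - r) * (a2 * b2) - X c * X x\<bar> \<le> X c * (1 - X c)"
        and decay: "r * (a1 * (1 - a1)) + (1 - r) * (a2 * (1 - a2))
          \<le> (1 - min (X x) (1 - X x)) * (X c * (1 - X c))"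
        by (rule simplify_cases[OF frac])
      define Y where "Y a b = X(c := a, x := b)" for a b
      have sub: "fractional n (Y a b) - set xs \<subseteq> {c, x}" for a b
      proof
        fix y assume y: "y \<in> fractional n (Y a b) - set xs"
        have "y \<in> fractional n X - set (x # xs)" if "y \<noteq> c" "y \<noteq> x"
          using y that by (simp add: Y_def fractional_def)
        then show "y \<in> {c, x}" unfolding 3(2) by blast
      qed
      have frac_c: "c \<in> fractional n (Y a b) \<longleftrightarrow> a \<in> {0<..<1}"
        and frac_x: "x \<in> fractional n (Y a b) \<longleftrightarrow> b \<in> {0<..<1}" for a b
        using cn xn cx by (simp_all add: Y_def fractional_def)
      \<comment> \<open>One of the two new entries is integral, so at most one of \<open>c\<close>
        and \<open>x\<close> remains as carrier.\<close>
      have state: "loop_state n \<pi> (Y a b) xs"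
        if "a \<in> {0..1}" "b \<in> {0..1}" "a \<notin> {0<..<1} \<or> b \<notin> {0<..<1}" for a b
      proof -
        have "c \<notin> fractional n (Y a b) \<or> x \<notin> fractional n (Y a b)"
          using that(3) unfolding frac_c frac_x .
        then obtain d where "fractional n (Y a b) - set xs \<subseteq> {d}"
          using sub[of a b] by blast
        from card_mono[OF _ this] have "card (fractional n (Y a b) - set xs) \<le> 1" by simp
        moreover have "\<pi> d < \<pi> y" if "d \<in> fractional n (Y a b) - set xs" "y \<in> set xs" for d y
        proof -
          have "d = c \<or> d = x" using sub[of a b] that by blast
          then show ?thesis using x_lt[OF that(2)] c_lt[OF _ that(2), of c] 3(2) by auto
        qed
        moreover have "\<forall>i\<in>{1..n}. Y a b i \<in> {0..1}"
          using X that by (auto simp: Y_def)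
        ultimately show ?thesis
          using sorted xs unfolding loop_state_def by blast
      qed
      let ?R = "\<Prod>i\<in>I - {c, x}. literal P X i"
      have R: "?R \<ge> 0"
      proof (rule prod_nonneg)
        fix i assume "i \<in> I - {c, x}"
        then have "X i \<in> {0..1}" using X I by blast
        from literal_bounds[where P = P and X = X and i = i, OF this]
        show "0 \<le> literal P X i" by simp
      qed
      have mono: "literal_prod I P (Y a b) =
         (if c \<in> I then literal P (\<lambda>_. a) c else 1) * (if x \<in> I then literal P (\<lambda>_. b) x else 1) * ?R" for a b
        unfolding Y_def by (rule literal_prod_upd[OF fI cx])
      have monoX: "literal_prod I P X =
         (if c \<in> I then literal P X c else 1) * (if x \<in> I then literal P X x else 1) * ?R"
        using literal_prod_upd[OF fI cx, of P X "X c" "X x"] by (simp add: literal_def)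
      have carrX: "carried n I P X (x # xs) = (if c \<in> I then literal_prod I P X * (1 - literal P X c) else 0)"
        using 3 frac cx c_xs by (intro carried_eq[OF I]) auto
      \<comment> \<open>If \<open>a\<close> is fractional then \<open>b\<close> is not, and only
        \<open>c\<close> can be the carrier. If \<open>a\<close> is 0 or 1, both sides vanish,
        because a carrier \<open>x\<close> would lie off \<open>I\<close>.\<close>
      have carr: "carried n I P (Y a b) xs = (if c \<in> I then a * (1 - a) * ?R else 0)"
        if "x \<notin> I" "a \<in> {0..1}" "b \<in> {0..1}" "a \<notin> {0<..<1} \<or> b \<notin> {0<..<1}" for a b
      proof (cases "c \<in> I \<and> a \<in> {0<..<1}")
        case True
        with that have "fractional n (Y a b) - set xs \<subseteq> {c}"
          using sub[of a b] frac_x[of a b] by blast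
        then have "carried n I P (Y a b) xs
            = (if c \<in> I then literal_prod I P (Y a b) * (1 - literal P (Y a b) c) else 0)"
          using that c_xs cx by (intro carried_eq[OF I]) (auto simp: Y_def)
        moreover have "literal P (Y a b) c = literal P (\<lambda>_. a) c"
          using cx by (simp add: Y_def literal_def)
        moreover have "literal P (\<lambda>_. a) c * (1 - literal P (\<lambda>_. a) c) = a * (1 - a)"
          by (auto simp: literal_def)
        ultimately show ?thesis
          using True that(1) unfolding mono by (simp add: mult_ac)
      next
        case False
        then have "(fractional n (Y a b) - set xs) \<inter> I = {}"
          using sub[of a b] that(1) frac_c[of a b] by blast
        then have "carried n I P (Y a b) xs = 0" unfolding carried_def by simp
        with False that show ?thesis by auto
      qed
      have states: "loop_state n \<pi> (Y a1 b1) xs" "loop_state n \<pi> (Y a2 b2) xs"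
        using range nf by (auto intro!: state)
      have agree: "Y a1 b1 y = X y \<and> Y a2 b2 y = X y" if "y \<in> set xs" for y
        using that x_xs c_xs by (auto simp: Y_def)
      have E: "measure_pmf.expectation (dep_round_loop n \<pi> X) f
        = r * measure_pmf.expectation (dep_round_loop n \<pi> (Y a1 b1)) f
        + (1 - r) * measure_pmf.expectation (dep_round_loop n \<pi> (Y a2 b2)) f" for f :: "_ \<Rightarrow> real"
        unfolding loop_unfold[OF st 3] simp_eq bind_map_pmf
        by (subst expectation_bind_bernoulli) (use r in \<open>auto simp: Y_def finite_set_pmf_dep_round_loop\<close>)
      have mart: "r * literal_prod I P (Y a1 b1) + (1 - r) * literal_prod I P (Y a2 b2) = literal_prod I P X"
        if "x \<notin> I"
      proof -
        have "r * literal P (\<lambda>_. a1) c + (1 - r) * literal P (\<lambda>_. a2) c = literal P X c"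
          unfolding literal_def mean_a[symmetric] by (auto simp: algebra_simps)
        then have "(r * literal P (\<lambda>_. a1) c + (1 - r) * literal P (\<lambda>_. a2) c) * ?R = literal P X c * ?R"
          by simp
        with that show ?thesis unfolding mono monoX by (simp add: algebra_simps)
      qed
      have decay: "r * carried n I P (Y a1 b1) xs + (1 - r) * carried n I P (Y a2 b2) xs
          \<le> (1 - min (X x) (1 - X x)) * carried n I P X (x # xs)" if "x \<notin> I"
      proof (cases "c \<in> I")
        case True
        have "carried n I P (Y a1 b1) xs = a1 * (1 - a1) * ?R"
          and "carried n I P (Y a2 b2) xs = a2 * (1 - a2) * ?R"
          using carr[of a1 b1] carr[of a2 b2] that True range nf by simp_all
        then have "r * carried n I P (Y a1 b1) xs + (1 - r) * carried n I P (Y a2 b2) xs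
            = (r * (a1 * (1 - a1)) + (1 - r) * (a2 * (1 - a2))) * ?R"
          by (simp only:) (simp add: algebra_simps)
        also have "\<dots> \<le> ((1 - min (X x) (1 - X x)) * (X c * (1 - X c))) * ?R"
          using decay R by (rule mult_right_mono)
        also have "\<dots> = (1 - min (X x) (1 - X x)) * carried n I P X (x # xs)"
          unfolding carrX monoX using True that by (simp add: literal_def)
        finally show ?thesis .
      next
        case False
        then show ?thesis
          using carr[of a1 b1] carr[of a2 b2] that range nf carrX by simp
      qed
      have dev: "\<bar>r * literal_prod I P (Y a1 b1) + (1 - r) * literal_prod I P (Y a2 b2) - literal_prod I P X\<bar>
          \<le> 1 / literal P X x * carried n I P X (x # xs)" if xI: "x \<in> I" and pos: "literal P X x > 0"
      proof (cases "c \<in> I")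
        case True
        let ?d = "r * (literal P (\<lambda>_. a1) c * literal P (\<lambda>_. b1) x)
          + (1 - r) * (literal P (\<lambda>_. a2) c * literal P (\<lambda>_. b2) x) - literal P X c * literal P X x"
        \<comment> \<open>Complementing one of the two literals reverses the sign of the covariance;
          complementing both restores it.\<close>
        have "?d = (if (c \<in> P) = (x \<in> P) then 1 else -1)
            * (r * (a1 * b1) + (1 - r) * (a2 * b2) - X c * X x)"
          unfolding literal_def mean_a[symmetric] mean_b[symmetric] by (auto simp: algebra_simps)
        then have d: "\<bar>?d\<bar> \<le> X c * (1 - X c)" using cov by (auto simp: abs_mult)
        have "r * literal_prod I P (Y a1 b1) + (1 - r) * literal_prod I P (Y a2 b2) - literal_prod I P X = ?d * ?R"
          unfolding mono monoX using True xI by (simp add: algebra_simps)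
        then have "\<bar>r * literal_prod I P (Y a1 b1) + (1 - r) * literal_prod I P (Y a2 b2) - literal_prod I P X\<bar>
            = \<bar>?d\<bar> * ?R"
          using R by (simp add: abs_mult)
        also have "\<dots> \<le> (X c * (1 - X c)) * ?R" using d R by (rule mult_right_mono)
        also have "\<dots> = 1 / literal P X x * carried n I P X (x # xs)"
        proof -
          have "literal P X c * (1 - literal P X c) = X c * (1 - X c)"
            by (auto simp: literal_def)
          then show ?thesis unfolding carrX monoX using True xI pos by simp
        qed
        finally show ?thesis .
      next
        case False
        \<comment> \<open>With \<open>c\<close> off \<open>I\<close> only the entry at
          \<open>x\<close> enters the product, and its mean is preserved.\<close>
        have "r * literal P (\<lambda>_. b1) x + (1 - r) * literal P (\<lambda>_. b2) x = literal P X x"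
          unfolding literal_def mean_b[symmetric] by (auto simp: algebra_simps)
        then have "(r * literal P (\<lambda>_. b1) x + (1 - r) * literal P (\<lambda>_. b2) x) * ?R = literal P X x * ?R"
          by simp
        with False xI have "r * literal_prod I P (Y a1 b1) + (1 - r) * literal_prod I P (Y a2 b2) = literal_prod I P X"
          unfolding mono monoX by (simp add: algebra_simps)
        then show ?thesis using carrX False by simp
      qed
      show ?thesis
        by (rule that[of r "Y a1 b1" "Y a2 b2"]) (use r states agree E mart decay dev in blast)+
    qed
  qed
qed

section \<open>Bounds for the expectation\<close>

text \<open>Induction along the order: linearity averages the two outcomes, and monotonicity then
  inserts the bounds of \<open>loop_step\<close>. Nonnegativity is carried along because the lower
  bound needs it where the penalty is large.\<close>

lemma loop_expectation_bounds:
  assumes "loop_state n \<pi> X xs" and I: "I \<subseteq> {1..n}"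
    and "\<And>x. x \<in> set xs \<inter> I \<Longrightarrow> literal P X x > 0 \<and> h x = 1 / literal P X x"
    and "\<And>x. x \<in> set xs - I \<Longrightarrow> h x = 1 - min (X x) (1 - X x)"
  shows "0 \<le> measure_pmf.expectation (dep_round_loop n \<pi> X) (literal_prod I P)
    \<and> measure_pmf.expectation (dep_round_loop n \<pi> X) (literal_prod I P)
        \<le> chain_bound I h xs (literal_prod I P X) (carried n I P X xs)
    \<and> literal_prod I P X - penalty I h xs (literal_prod I P X) (carried n I P X xs)
        \<le> measure_pmf.expectation (dep_round_loop n \<pi> X) (literal_prod I P)"
  using assms(1,3,4)
proof (induction xs arbitrary: X)
  case Nil
  then have "\<forall>i\<in>{1..n}. X i \<in> {0..1}" "card (fractional n X) \<le> 1"
    by (auto simp: loop_state_def)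
  with literal_prod_bounds[OF I, of X P] show ?case
    by (subst (1 2 3) dep_round_loop.simps) simp
next
  case (Cons x xs)
  let ?E = "\<lambda>X. measure_pmf.expectation (dep_round_loop n \<pi> X) (literal_prod I P)"
  let ?W = "literal_prod I P" and ?V = "carried n I P"
  obtain r X1 X2 where r: "0 \<le> r" "r \<le> 1"
    and st: "loop_state n \<pi> X1 xs" "loop_state n \<pi> X2 xs"
    and agree: "\<forall>y\<in>set xs. X1 y = X y \<and> X2 y = X y"
    and E: "\<forall>f::(nat \<Rightarrow> real) \<Rightarrow> real. measure_pmf.expectation (dep_round_loop n \<pi> X) f
        = r * measure_pmf.expectation (dep_round_loop n \<pi> X1) f
        + (1 - r) * measure_pmf.expectation (dep_round_loop n \<pi> X2) f"
    and dev: "x \<in> I \<longrightarrow> literal P X x > 0 \<longrightarrow>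
      \<bar>r * ?W X1 + (1 - r) * ?W X2 - ?W X\<bar> \<le> 1 / literal P X x * ?V X (x # xs)"
    and mart: "x \<notin> I \<longrightarrow> r * ?W X1 + (1 - r) * ?W X2 = ?W X"
    and decay: "x \<notin> I \<longrightarrow> r * ?V X1 xs + (1 - r) * ?V X2 xs
        \<le> (1 - min (X x) (1 - X x)) * ?V X (x # xs)"
    by (rule loop_step[OF Cons.prems(1) I, of P])
  have "\<forall>i\<in>{1..n}. X i \<in> {0..1}" "set (x # xs) \<subseteq> {1..n}"
    using Cons.prems(1) by (auto simp: loop_state_def)
  then have hx: "h y \<ge> 0" if "y \<in> set (x # xs)" for y
    using that Cons.prems(2)[of y] Cons.prems(3)[of y] by (cases "y \<in> I") (auto dest!: subsetD)
  have lit: "literal P X1 y = literal P X y" "literal P X2 y = literal P X y" if "y \<in> set xs" for y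
    using agree that by (simp_all add: literal_def)
  have IH1: "0 \<le> ?E X1 \<and> ?E X1 \<le> chain_bound I h xs (?W X1) (?V X1 xs)
      \<and> ?W X1 - penalty I h xs (?W X1) (?V X1 xs) \<le> ?E X1"
    using Cons.prems agree lit by (intro Cons.IH st) auto
  have IH2: "0 \<le> ?E X2 \<and> ?E X2 \<le> chain_bound I h xs (?W X2) (?V X2 xs)
      \<and> ?W X2 - penalty I h xs (?W X2) (?V X2 xs) \<le> ?E X2"
    using Cons.prems agree lit by (intro Cons.IH st) auto
  define W where "W = r * ?W X1 + (1 - r) * ?W X2"
  define V where "V = r * ?V X1 xs + (1 - r) * ?V X2 xs"
  have nonneg: "0 \<le> ?E X" unfolding E[rule_format] using r IH1 IH2 by simp
  have "?E X \<le> r * chain_bound I h xs (?W X1) (?V X1 xs) + (1 - r) * chain_bound I h xs (?W X2) (?V X2 xs)"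
    unfolding E[rule_format] using r IH1 IH2 by (intro add_mono mult_left_mono) auto
  then have up: "?E X \<le> chain_bound I h xs W V"
    unfolding W_def V_def chain_bound_linear .
  have "r * (?W X1 - penalty I h xs (?W X1) (?V X1 xs)) + (1 - r) * (?W X2 - penalty I h xs (?W X2) (?V X2 xs)) \<le> ?E X"
    unfolding E[rule_format] using r IH1 IH2 by (intro add_mono mult_left_mono) auto
  then have low: "W - penalty I h xs W V \<le> ?E X"
    unfolding W_def V_def penalty_linear by (simp add: algebra_simps)
  have VW: "V \<le> W"
    unfolding V_def W_def using r carried_bounds(2)[OF I] st by (intro add_mono mult_left_mono) auto
  have VX: "0 \<le> ?V X (x # xs)" "?V X (x # xs) \<le> ?W X"
    using carried_bounds[OF I Cons.prems(1)] by auto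
  show ?case
  proof (cases "x \<in> I")
    case False
    then have W: "W = ?W X" and V: "V \<le> h x * ?V X (x # xs)"
      using mart decay Cons.prems(3)[of x] by (auto simp: W_def V_def)
    have "chain_bound I h xs W V \<le> chain_bound I h xs W (h x * ?V X (x # xs))"
      using hx V by (intro chain_bound_mono) auto
    moreover have "penalty I h xs W V \<le> penalty I h xs W (h x * ?V X (x # xs))"
      using hx V by (intro penalty_mono) auto
    ultimately show ?thesis
      using False up low nonneg W by simp
  next
    case True
    let ?d = "h x * ?V X (x # xs)"
    have "\<bar>W - ?W X\<bar> \<le> ?d" using dev Cons.prems(2)[of x] True by (simp add: W_def)
    then have W: "W \<le> ?W X + ?d" "?W X - ?d \<le> W" by linarith+
    have "chain_bound I h xs W V \<le> chain_bound I h xs (?W X + ?d) (?W X + ?d)"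
      using hx W VW by (intro chain_bound_mono) auto
    \<comment> \<open>The averaged value \<open>W\<close> may fall short of \<open>?W X\<close> by
      \<open>?d\<close>, and the lower bound is monotone in it only while
      \<open>penalty I h xs 1 1 \<le> 1\<close>. Beyond that the claimed bound is at most 0, and
      nonnegativity of the expectation suffices.\<close>
    moreover have "?W X - (?d + penalty I h xs (?W X) (?W X)) \<le> ?E X"
    proof -
      have d0: "0 \<le> ?d" using hx VX by simp
      have scale: "penalty I h xs c c = c * penalty I h xs 1 1" for c
        using penalty_linear[of I h xs c 1 0 0 1 0] by simp
      have p0: "0 \<le> penalty I h xs 1 1"
        using hx by (intro penalty_nonneg) auto
      have "penalty I h xs W V \<le> penalty I h xs W W"
        using hx VW by (intro penalty_mono) auto
      with low have low': "W * (1 - penalty I h xs 1 1) \<le> ?E X"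
        unfolding scale[of W] by (simp add: algebra_simps)
      show ?thesis
      proof (cases "penalty I h xs 1 1 \<le> 1")
        case True
        then have "(?W X - ?d) * (1 - penalty I h xs 1 1) \<le> W * (1 - penalty I h xs 1 1)"
          using W by (intro mult_right_mono) auto
        moreover have "0 \<le> ?d * penalty I h xs 1 1" using d0 p0 by simp
        ultimately show ?thesis
          using low' unfolding scale[of "?W X"] by (simp add: algebra_simps)
      next
        case False
        then have "?W X * 1 \<le> ?W X * penalty I h xs 1 1"
          using VX by (intro mult_left_mono) auto
        then show ?thesis using d0 nonneg unfolding scale[of "?W X"] by simp
      qed
    qed
    ultimately show ?thesis using True up nonneg by simp
  qed
qed

section \<open>Preservation of the sum and integrality\<close>

lemma dep_round_loop_final:
  assumes "X' \<in> set_pmf (dep_round_loop n \<pi> X)" "\<forall>i\<in>{1..n}. X i \<in> {0..1}"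
  shows "(\<Sum>i\<in>{1..n}. X' i) = (\<Sum>i\<in>{1..n}. X i) \<and> (\<forall>i\<in>{1..n}. X' i \<in> {0..1})
    \<and> card (fractional n X') \<le> 1"
  using assms
proof (induction n \<pi> X rule: dep_round_loop.induct)
  case (1 n \<pi> X)
  show ?case
  proof (cases "2 \<le> card (fractional n X)")
    case False
    then have "X' = X" using 1(2) by (subst (asm) dep_round_loop.simps) simp
    with False 1 show ?thesis by auto
  next
    case True
    let ?F = "fractional n X"
    define i where "i = arg_min_on \<pi> ?F"
    define j where "j = arg_min_on \<pi> (?F - {i})"
    have ne: "?F \<noteq> {}" "?F - {i} \<noteq> {}"
      using True by (auto dest: card_mono[rotated])
    have iF: "i \<in> ?F" unfolding i_def using ne by (intro arg_min_if_finite(1)) auto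
    have jF: "j \<in> ?F - {i}" unfolding j_def by (rule arg_min_if_finite(1)) (use ne in auto)
    obtain \<gamma> where \<gamma>: "\<gamma> \<in> set_pmf (simplify (X i) (X j))"
      and X': "X' \<in> set_pmf (dep_round_loop n \<pi> (X(i := fst \<gamma>, j := snd \<gamma>)))"
      using 1(2) True by (subst (asm) dep_round_loop.simps) (auto simp: Let_def i_def j_def)
    have fr: "X i \<in> {0<..<1}" "X j \<in> {0<..<1}" and ij: "i \<noteq> j" "i \<in> {1..n}" "j \<in> {1..n}"
      using iF jF by (auto simp: fractional_def)
    have g: "fst \<gamma> \<in> {0..1}" "snd \<gamma> \<in> {0..1}" "fst \<gamma> + snd \<gamma> = X i + X j"
      using \<gamma> fr by (auto simp: simplify_def split: if_splits)
    let ?Y = "X(i := fst \<gamma>, j := snd \<gamma>)"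
    have Y: "\<forall>i\<in>{1..n}. ?Y i \<in> {0..1}" using 1(3) g by auto
    have split: "(\<Sum>k\<in>{1..n}. Z k) = Z i + Z j + (\<Sum>k\<in>{1..n} - {i} - {j}. Z k)" for Z :: "nat \<Rightarrow> real"
      using ij sum.remove[of "{1..n}" i Z] sum.remove[of "{1..n} - {i}" j Z] by simp
    have "(\<Sum>k\<in>{1..n}. ?Y k) = (\<Sum>k\<in>{1..n}. X k)"
      unfolding split using ij g by simp
    moreover have "(\<Sum>i\<in>{1..n}. X' i) = (\<Sum>i\<in>{1..n}. ?Y i) \<and> (\<forall>i\<in>{1..n}. X' i \<in> {0..1})
        \<and> card (fractional n X') \<le> 1"
      using 1(1)[OF True i_def _ \<gamma> X' Y] by (simp add: j_def i_def)
    ultimately show ?thesis by simp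
  qed
qed

text \<open>A lone fractional entry would be the integral total minus a sum of integers, hence an
  integer strictly between 0 and 1.\<close>

lemma fractional_empty_if_sum_int:
  assumes range: "\<forall>i\<in>{1..n}. X i \<in> {0..1}" and card: "card (fractional n X) \<le> 1"
    and int: "(\<Sum>i\<in>{1..n}. X i) \<in> \<int>"
  shows "fractional n X = {}"
proof (rule ccontr)
  assume "fractional n X \<noteq> {}"
  with card have "card (fractional n X) = 1" by (simp add: le_eq_less_or_eq)
  then obtain c where c: "fractional n X = {c}" by (rule card_1_singletonE)
  have "X i \<in> \<int>" if "i \<in> {1..n} - {c}" for i
  proof -
    have "i \<notin> fractional n X" using that c by simp
    then have "X i = 0 \<or> X i = 1" using that bspec[OF range, of i] by (auto simp: fractional_def)
    then show ?thesis by auto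
  qed
  then have "(\<Sum>i\<in>{1..n} - {c}. X i) \<in> \<int>" by (intro Ints_sum)
  moreover have "c \<in> fractional n X" using c by simp
  then have cn: "c \<in> {1..n}" "0 < X c" "X c < 1" by (simp_all add: fractional_def)
  moreover have "(\<Sum>i\<in>{1..n}. X i) = X c + (\<Sum>i\<in>{1..n} - {c}. X i)"
    using cn by (intro sum.remove) auto
  ultimately have "X c \<in> \<int>" using int Ints_diff by fastforce
  with cn show False by (auto elim!: Ints_cases)
qed

section \<open>Averaging over the random order\<close>

lemma bij_betw_permutes_permutations_of_set:
  assumes "distinct xs"
  shows "bij_betw (\<lambda>\<pi>. map (inv \<pi>) xs) {\<pi>. \<pi> permutes set xs} (permutations_of_set (set xs))"
proof -
  let ?P = "{\<pi>. \<pi> permutes set xs}" and ?f = "\<lambda>\<pi>. map (inv \<pi>) xs"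
  have inj: "inj_on ?f ?P"
  proof (rule inj_onI)
    fix \<pi> \<rho> assume \<pi>: "\<pi> \<in> ?P" and \<rho>: "\<rho> \<in> ?P" and eq: "?f \<pi> = ?f \<rho>"
    then have perm: "inv \<pi> permutes set xs" "inv \<rho> permutes set xs"
      by (auto intro: permutes_inv)
    have "inv \<pi> x = inv \<rho> x" for x
      using eq permutes_not_in[OF perm(1), of x] permutes_not_in[OF perm(2), of x]
      by (cases "x \<in> set xs") auto
    then have "inv \<pi> = inv \<rho>" by blast
    then show "\<pi> = \<rho>" using \<pi> \<rho> by (metis mem_Collect_eq permutes_inv_inv)
  qed
  have "?f ` ?P \<subseteq> permutations_of_set (set xs)"
  proof (intro image_subsetI)
    fix \<pi> assume "\<pi> \<in> ?P"
    then have "inv \<pi> permutes set xs" by (auto intro: permutes_inv)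
    then show "?f \<pi> \<in> permutations_of_set (set xs)"
      using assms permutes_image[of "inv \<pi>" "set xs"] permutes_inj_on[of "inv \<pi>" "set xs"]
      by (auto simp: permutations_of_set_def distinct_map)
  qed
  moreover have "card (?f ` ?P) = card (permutations_of_set (set xs))"
    using inj by (simp add: card_image card_permutations)
  ultimately show ?thesis
    using inj by (simp add: bij_betw_def card_subset_eq)
qed

text \<open>A uniform permutation yields a uniform order of visits, so the averaged bounds on
  \<open>chain_bound\<close> and \<open>penalty\<close> apply. The number \<open>y\<close> is the
  ratio of t to the product of n and the two means in the final statement, as the sum of the
  \<open>1 / q\<close> is t divided by their harmonic mean.\<close>

lemma dep_round_literal_prod_bounds:
  fixes a :: real
  assumes p: "\<forall>i\<in>{1..n}. p i \<in> {0..1}" and I: "I \<subseteq> {1..n}" "I \<noteq> {}" and J: "{1..n} - I \<noteq> {}"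
    and pos: "\<And>i. i \<in> I \<Longrightarrow> literal P p i > 0"
    and a: "(\<Sum>j\<in>{1..n} - I. min (p j) (1 - p j)) / card ({1..n} - I) = a" "0 < a"
  defines "y \<equiv> (\<Sum>i\<in>I. 1 / literal P p i) / (n * a)"
  shows "(1 - real (card I - 1) * y) * literal_prod I P p
          \<le> measure_pmf.expectation (dep_round n p) (literal_prod I P)"
    and "measure_pmf.expectation (dep_round n p) (literal_prod I P)
          \<le> (1 + y) ^ (card I - 1) * literal_prod I P p"
proof -
  let ?S = "{1..n}" and ?lam = "literal_prod I P p" and ?Pi = "{\<pi>. \<pi> permutes {1..n}}"
  define h where "h x = (if x \<in> I then 1 / literal P p x else 1 - min (p x) (1 - p x))" for x
  have h: "h x \<ge> 0" if "x \<in> ?S" for x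
    using bspec[OF p that] pos[of x] by (auto simp: h_def)
  have hI: "sum h I = (\<Sum>i\<in>I. 1 / literal P p i)"
    by (intro sum.cong) (auto simp: h_def)
  have hJ: "sum h (?S - I) / card (?S - I) = 1 - a"
  proof -
    have "sum h (?S - I) = (\<Sum>j\<in>?S - I. 1 - min (p j) (1 - p j))"
      by (intro sum.cong) (auto simp: h_def)
    then have "sum h (?S - I) / card (?S - I)
        = (real (card (?S - I)) - (\<Sum>j\<in>?S - I. min (p j) (1 - p j))) / card (?S - I)"
      by (simp only: sum_subtractf) simp
    also have "\<dots> = 1 - a"
    proof -
      have "card (?S - I) \<noteq> 0" using J by (simp only: card_0_eq finite_Diff finite_atLeastAtMost) simp
      then show ?thesis unfolding a(1)[symmetric] diff_divide_distrib by simp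
    qed
    finally show ?thesis .
  qed
  define E where "E \<pi> = measure_pmf.expectation (dep_round_loop n \<pi> p) (literal_prod I P)" for \<pi>
  \<comment> \<open>Since \<open>\<pi>\<close> sends an index to its position, its inverse lists the
    indices in the order of visit.\<close>
  define order where "order \<pi> = map (inv \<pi>) [1..<Suc n]" for \<pi> :: "nat \<Rightarrow> nat"
  have lam: "0 \<le> ?lam" using literal_prod_bounds[OF I(1) p, of P] by simp
  have E_bounds: "?lam * (1 - penalty I h (order \<pi>) 1 0) \<le> E \<pi> \<and> E \<pi> \<le> ?lam * chain_bound I h (order \<pi>) 1 0"
    if "\<pi> permutes ?S" for \<pi>
  proof -
    have set: "set (order \<pi>) = ?S"
      using permutes_image[OF permutes_inv[OF that]]
      by (simp only: order_def set_map set_upt atLeastLessThanSuc_atLeastAtMost)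
    have "sorted_wrt (\<lambda>i j. \<pi> i < \<pi> j) (order \<pi>)"
      unfolding order_def sorted_wrt_map permutes_inverses(1)[OF that] by (rule sorted_wrt_upt)
    \<comment> \<open>At the start every index is unvisited, so there is no carrier and the pair is
      \<open>(?lam, 0)\<close>.\<close>
    moreover have empty: "fractional n p - set (order \<pi>) = {}"
      unfolding set by (auto simp: fractional_def)
    ultimately have st: "loop_state n \<pi> p (order \<pi>)"
      unfolding loop_state_def empty using p set by simp
    have carr: "carried n I P p (order \<pi>) = 0" unfolding carried_def empty by simp
    have "chain_bound I h (order \<pi>) ?lam 0 = ?lam * chain_bound I h (order \<pi>) 1 0"
      using chain_bound_linear[of I h "order \<pi>" ?lam 1 0 0 0 0] by simp
    moreover have "penalty I h (order \<pi>) ?lam 0 = ?lam * penalty I h (order \<pi>) 1 0"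
      using penalty_linear[of I h "order \<pi>" ?lam 1 0 0 0 0] by simp
    ultimately show ?thesis
      using loop_expectation_bounds[OF st I(1), of P h] pos
      unfolding carr E_def by (auto simp: h_def algebra_simps)
  qed
  have reindex: "(\<Sum>\<pi>\<in>?Pi. f (order \<pi>)) = (\<Sum>xs\<in>permutations_of_set ?S. f xs)"
    for f :: "nat list \<Rightarrow> real"
    using sum.reindex_bij_betw[OF bij_betw_permutes_permutations_of_set[of "[1..<Suc n]"], of f]
    by (simp add: order_def atLeastLessThanSuc_atLeastAtMost del: upt_Suc)
  have card_Pi: "card ?Pi = fact n" by (simp add: card_permutations)
  have "?Pi \<noteq> {}" using permutes_id by blast
  then have "measure_pmf.expectation (dep_round n p) (literal_prod I P)
      = (\<Sum>\<pi>\<in>?Pi. E \<pi> /\<^sub>R real (card ?Pi))"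
    unfolding dep_round_def E_def
    by (intro pmf_expectation_bind_pmf_of_set)
       (auto simp: finite_permutations finite_set_pmf_dep_round_loop)
  then have E: "measure_pmf.expectation (dep_round n p) (literal_prod I P) = (\<Sum>\<pi>\<in>?Pi. E \<pi>) / fact n"
    unfolding card_Pi scaleR_sum_right[symmetric] by (simp add: field_simps)
  have "(\<Sum>\<pi>\<in>?Pi. E \<pi>) \<le> (\<Sum>\<pi>\<in>?Pi. ?lam * chain_bound I h (order \<pi>) 1 0)"
    using E_bounds by (intro sum_mono) auto
  also have "\<dots> = ?lam * (\<Sum>xs\<in>permutations_of_set ?S. chain_bound I h xs 1 0)"
    unfolding sum_distrib_left[symmetric] reindex[of "\<lambda>xs. chain_bound I h xs 1 0"] ..
  also have "\<dots> \<le> ?lam * (fact (card ?S) * (1 + sum h I / (card ?S * a)) ^ (card I - 1))"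
    using h hJ I J a by (intro mult_left_mono sum_permutations_chain_bound_le lam) auto
  finally show "measure_pmf.expectation (dep_round n p) (literal_prod I P)
          \<le> (1 + y) ^ (card I - 1) * literal_prod I P p"
    unfolding E hI by (simp add: y_def field_simps)
  have "?lam * (fact n - fact n * (real (card I - 1) * y)) \<le>
      ?lam * (fact n - (\<Sum>xs\<in>permutations_of_set ?S. penalty I h xs 1 0))"
    using sum_permutations_penalty_le[of ?S I h a] h hJ I J a
    by (intro mult_left_mono lam) (auto simp: y_def hI)
  also have "\<dots> = (\<Sum>\<pi>\<in>?Pi. ?lam * (1 - penalty I h (order \<pi>) 1 0))"
    unfolding sum_distrib_left[symmetric] sum_subtractf
      reindex[of "\<lambda>xs. penalty I h xs 1 0", symmetric]
    using card_Pi by simp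
  also have "\<dots> \<le> (\<Sum>\<pi>\<in>?Pi. E \<pi>)"
    using E_bounds by (intro sum_mono) auto
  finally show "(1 - real (card I - 1) * y) * literal_prod I P p
          \<le> measure_pmf.expectation (dep_round n p) (literal_prod I P)"
    unfolding E by (simp add: field_simps)
qed

theorem theorem2p12:
  fixes n :: nat and p :: "nat \<Rightarrow> real"
  assumes p: "\<forall>i\<in>{1..n}. 0 \<le> p i \<and> p i \<le> 1"
  shows "(\<forall>Ip Im. Ip \<subseteq> {1..n} \<longrightarrow> Im \<subseteq> {1..n} \<longrightarrow> Ip \<inter> Im = {} \<longrightarrow>
           (let I = Ip \<union> Im;
                t = card I;
                J = {1..n} - I;
                \<alpha> = (\<lambda>i. min (p i) (1 - p i));
                q = (\<lambda>i. if i \<in> Ip then p i else 1 - p i);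
                lam = (\<Prod>i\<in>Ip. p i) * (\<Prod>i\<in>Im. 1 - p i);
                \<alpha>hat = 1 / real (card J) * (\<Sum>j\<in>J. \<alpha> j);
                qhat = 1 / (1 / real (card I) * (\<Sum>i\<in>I. 1 / q i));
                E = measure_pmf.expectation (dep_round n p)
                      (\<lambda>X. (\<Prod>i\<in>Ip. X i) * (\<Prod>i\<in>Im. 1 - X i))
            in J \<noteq> {} \<longrightarrow> (\<forall>i\<in>I. q i > 0) \<longrightarrow> \<alpha>hat > 0 \<longrightarrow>
                 (1 - real t * (real t - 1) / (real n * qhat * \<alpha>hat)) * lam \<le> E \<and>
                 E \<le> (1 + real t / (real n * qhat * \<alpha>hat)) ^ (t - 1) * lam)) \<and>
         ((\<Sum>i\<in>{1..n}. p i) \<in> \<int> \<longrightarrow>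
           (\<forall>X\<in>set_pmf (dep_round n p). fractional n X = {}))"
proof (intro conjI allI impI ballI)
  fix Ip Im
  assume sub: "Ip \<subseteq> {1..n}" "Im \<subseteq> {1..n}" and disj: "Ip \<inter> Im = {}"
  define I where "I = Ip \<union> Im"
  define J where "J = {1..n} - I"
  define ahat where "ahat = 1 / real (card J) * (\<Sum>j\<in>J. min (p j) (1 - p j))"
  define Q where "Q = (\<Sum>i\<in>I. 1 / (if i \<in> Ip then p i else 1 - p i))"
  define t where "t = card I"
  have fin: "finite Ip" "finite Im" using sub finite_subset by auto
  have mono: "(\<lambda>X. (\<Prod>i\<in>Ip. X i) * (\<Prod>i\<in>Im. 1 - X i)) = literal_prod I Ip"
  proof
    fix X :: "nat \<Rightarrow> real"
    have "prod (literal Ip X) Im = (\<Prod>i\<in>Im. 1 - X i)"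
      using disj by (intro prod.cong) (auto simp: literal_def)
    moreover have "prod (literal Ip X) Ip = (\<Prod>i\<in>Ip. X i)"
      by (intro prod.cong) (auto simp: literal_def)
    ultimately show "(\<Prod>i\<in>Ip. X i) * (\<Prod>i\<in>Im. 1 - X i) = literal_prod I Ip X"
      unfolding literal_prod_def I_def prod.union_disjoint[OF fin disj] by simp
  qed
  have lam: "(\<Prod>i\<in>Ip. p i) * (\<Prod>i\<in>Im. 1 - p i) = literal_prod I Ip p"
    using fun_cong[OF mono] .
  have "(1 - real t * (real t - 1) / (real n * (1 / (1 / real t * Q)) * ahat)) * literal_prod I Ip p
          \<le> measure_pmf.expectation (dep_round n p) (literal_prod I Ip) \<and>
        measure_pmf.expectation (dep_round n p) (literal_prod I Ip)
          \<le> (1 + real t / (real n * (1 / (1 / real t * Q)) * ahat)) ^ (t - 1) * literal_prod I Ip p"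
    if J_ne: "J \<noteq> {}" and q: "\<forall>i\<in>I. (if i \<in> Ip then p i else 1 - p i) > 0" and a: "ahat > 0"
  proof (cases "I = {}")
    \<comment> \<open>Here \<open>t = 0\<close>: both fractions have numerator 0, the truncated
      exponent \<open>t - 1\<close> is 0, and the empty product is 1, so both bounds are
      equalities.\<close>
    case True
    then show ?thesis by (simp add: t_def literal_prod_def[abs_def])
  next
    case False
    have "finite I" using fin by (simp add: I_def)
    with False have t: "t > 0" by (simp add: t_def card_gt_0_iff)
    have Q: "Q > 0" unfolding Q_def using q False \<open>finite I\<close> by (intro sum_pos) auto
    have Q': "(\<Sum>i\<in>I. 1 / literal Ip p i) = Q" by (simp add: Q_def literal_def)
    have y: "real t / (real n * (1 / (1 / real t * Q)) * ahat) = Q / (real n * ahat)"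
      using t Q by (simp add: field_simps)
    have y': "real t * (real t - 1) / (real n * (1 / (1 / real t * Q)) * ahat)
        = real (t - 1) * (Q / (real n * ahat))"
      unfolding y[symmetric] using t by (simp add: of_nat_diff)
    have I: "I \<subseteq> {1..n}" "{1..n} - I \<noteq> {}"
      using J_ne sub by (auto simp: J_def I_def)
    have ahat: "(\<Sum>j\<in>{1..n} - I. min (p j) (1 - p j)) / card ({1..n} - I) = ahat"
      by (simp add: ahat_def J_def)
    have p': "\<forall>i\<in>{1..n}. p i \<in> {0..1}" using p by simp
    have pos: "literal Ip p i > 0" if "i \<in> I" for i
      using bspec[OF q that] by (simp add: literal_def)
    show ?thesis
      unfolding y y'
      using dep_round_literal_prod_bounds[where P = Ip, OF p' I(1) False I(2) pos ahat a]
      unfolding Q' t_def[symmetric] by blast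
  qed
  then show "let I = Ip \<union> Im;
                t = card I;
                J = {1..n} - I;
                \<alpha> = (\<lambda>i. min (p i) (1 - p i));
                q = (\<lambda>i. if i \<in> Ip then p i else 1 - p i);
                lam = (\<Prod>i\<in>Ip. p i) * (\<Prod>i\<in>Im. 1 - p i);
                \<alpha>hat = 1 / real (card J) * (\<Sum>j\<in>J. \<alpha> j);
                qhat = 1 / (1 / real (card I) * (\<Sum>i\<in>I. 1 / q i));
                E = measure_pmf.expectation (dep_round n p)
                      (\<lambda>X. (\<Prod>i\<in>Ip. X i) * (\<Prod>i\<in>Im. 1 - X i))
            in J \<noteq> {} \<longrightarrow> (\<forall>i\<in>I. q i > 0) \<longrightarrow> \<alpha>hat > 0 \<longrightarrow>
                 (1 - real t * (real t - 1) / (real n * qhat * \<alpha>hat)) * lam \<le> E \<and>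
                 E \<le> (1 + real t / (real n * qhat * \<alpha>hat)) ^ (t - 1) * lam"
    unfolding Let_def mono lam Q_def[symmetric] I_def[symmetric] J_def[symmetric] t_def[symmetric]
      ahat_def[symmetric] by blast
next
  fix X assume int: "(\<Sum>i\<in>{1..n}. p i) \<in> \<int>" and X: "X \<in> set_pmf (dep_round n p)"
  have "{\<pi>. \<pi> permutes {1..n}} \<noteq> {}" using permutes_id by blast
  with X obtain \<pi> where "X \<in> set_pmf (dep_round_loop n \<pi> p)"
    by (auto simp: dep_round_def finite_permutations)
  with p int show "fractional n X = {}"
    using dep_round_loop_final[of X n \<pi> p] by (intro fractional_empty_if_sum_int) auto
qed

end
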